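(* For every integer $k\ge 4$, every uncompletable word for $S_k$ has length at least $5k^2-17k+13$. Consequently (together with the existence of an uncompletable word of that length), the length of a minimal uncompletable word for $S_k$ equals $5k^2-17k+13$.
   Context: $\Sigma=\{a,b\}$. $S_k=\left(\Sigma^k\setminus\{ba^{k-1},b^{k-1}a\}\right)\cup\left(\Sigma^{k-1}\setminus\{a^{k-1},b^{k-1}\}\right)$. $\mathit{Fact}(S^* )$ is the set of all factors of words in $S^*$. A word $w\in\Sigma^*\setminus\mathit{Fact}(S_k^* )$ is called uncompletable for $S_k$; a minimal uncompletable word is an uncompletable word of minimal length. *)

theory Defs
  imports Main
begin

datatype letter = A | B

definition words_of_length :: "nat \<Rightarrow> letter list set" where
  "words_of_length n = {w. length w = n}"

definition S :: "nat \<Rightarrow> letter list set" where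
  "S k = (words_of_length k - {B # replicate (k-1) A, replicate (k-1) B @ [A]})
         \<union> (words_of_length (k-1) - {replicate (k-1) A, replicate (k-1) B})"

definition star :: "letter list set \<Rightarrow> letter list set" where
  "star X = {concat ws | ws. set ws \<subseteq> X}"

definition Fact :: "letter list set \<Rightarrow> letter list set" where
  "Fact L = {w. \<exists>u v. u @ w @ v \<in> L}"

definition uncompletable :: "nat \<Rightarrow> letter list \<Rightarrow> bool" where
  "uncompletable k w \<longleftrightarrow> w \<notin> Fact (star (S k))"

end

theory Submission
  imports Defs
begin

text \<open>
  A word is completable iff a cut between two blocks of \<^term>\<open>S k\<close> can be propagated from one of
  its first \<open>k\<close> positions to one of its last \<open>k\<close>. Whether position \<open>p\<close> is a reachable cut depends
  only on the positions \<open>p - k\<close> and \<open>p - k + 1\<close> and on the letters in between: usually it is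
  reachable as soon as one of these is, but directly after \<open>ba\<^sup>k\<^sup>-\<^sup>1\<close> it is lost, directly after
  \<open>b\<^sup>k\<^sup>-\<^sup>1a\<close> it copies \<open>p - k + 1\<close>, and directly after other \<open>k\<close> letters ending in \<open>k - 1\<close> equal
  ones it copies \<open>p - k\<close>. So an
  uncompletable word has to wipe out all reachable cuts, while in every revolution of length \<open>k\<close>
  each maximal run of reachable cuts grows by one to the left unless a run of equal letters holds
  its left end.

  The spacing constraints between these events show that a run of reachable cuts shrinks by at most
  one in \<open>5k - 4\<close> steps: within five revolutions at most four cuts are removed at the right end and
  the left end is held at most twice. This is made precise by a potential: the remaining length
  is bounded below by \<open>5k - 3\<close> per reachable cut in a window, up to a constant that depends on the
  shape of the window and the latest event. The extremal word runs through the tight cycle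
  \<open>a\<^sup>k\<^sup>+\<^sup>ib\<^sup>2\<^sup>k\<^sup>-\<^sup>3\<^sup>-\<^sup>ia\<^sup>kb\<^sup>k\<^sup>-\<^sup>1\<close> for \<open>i = 1, \<dots>, k - 3\<close>.
\<close>

section \<open>The recurrence for reachable cuts\<close>

text \<open>No block of \<^term>\<open>S k\<close> ends at a \<open>kill_at\<close> position, only blocks of length \<open>k - 1\<close> may end at
  a \<open>shift_at\<close> position, and only blocks of length \<open>k\<close> at another position satisfying \<open>run_end\<close>.\<close>

definition run_end :: "letter \<Rightarrow> int \<Rightarrow> (int \<Rightarrow> letter) \<Rightarrow> int \<Rightarrow> bool" where
  "run_end c k w p \<longleftrightarrow> (\<forall>i. p - k < i \<and> i < p \<longrightarrow> w i = c)"

definition kill_at :: "int \<Rightarrow> (int \<Rightarrow> letter) \<Rightarrow> int \<Rightarrow> bool" where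
  "kill_at k w p \<longleftrightarrow> run_end A k w p \<and> w (p - k) = B"

definition shift_at :: "int \<Rightarrow> (int \<Rightarrow> letter) \<Rightarrow> int \<Rightarrow> bool" where
  "shift_at k w p \<longleftrightarrow> run_end B k w (p - 1) \<and> w (p - 1) = A"

text \<open>\<open>r p\<close> means that a block boundary just before letter \<open>p\<close> is
  reachable. Integer positions keep the many offsets free of truncated subtraction.\<close>

locale cut_recurrence =
  fixes k :: int and w :: "int \<Rightarrow> letter" and r :: "int \<Rightarrow> bool"
  assumes k4: "4 \<le> k"
    and rec: "k \<le> p \<Longrightarrow> r p \<longleftrightarrow>
      r (p - k) \<and> \<not> kill_at k w p \<and> \<not> shift_at k w p \<or>
      r (p - k + 1) \<and> \<not> run_end A k w p \<and> \<not> run_end B k w p"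
begin

abbreviation "a_run \<equiv> run_end A k w"
abbreviation "b_run \<equiv> run_end B k w"
abbreviation "kill \<equiv> kill_at k w"
abbreviation "shift \<equiv> shift_at k w"

section \<open>Spacing constraints between runs, kills and shifts\<close>

lemma a_run_b_run:
  assumes "a_run q" "b_run q'"
  shows "q + k - 1 \<le> q' \<or> q' + k - 1 \<le> q"
proof (rule ccontr)
  assume *: "\<not> ?thesis"
  \<comment> \<open>The first letter of the later run; if the two runs overlap, it belongs to
    both.\<close>
  define i where "i = max q q' - k + 1"
  have "q - k < i" "i < q" "q' - k < i" "i < q'" using * k4 by (auto simp: i_def)
  then have "w i = A" "w i = B" using assms by (auto simp: run_end_def)
  then show False by simp
qed

lemma kill_a_run: "kill z \<Longrightarrow> a_run z"
  by (simp add: kill_at_def)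

lemma shift_b_run: "shift x \<Longrightarrow> b_run (x - 1)"
  by (simp add: shift_at_def)

lemma kill_vs_a_run:
  assumes "kill z" "a_run q" shows "q \<le> z - k \<or> z \<le> q"
proof (rule ccontr)
  assume "\<not> ?thesis"
  then have "w (z - k) = A" using assms(2) k4 by (auto simp: run_end_def)
  then show False using assms(1) by (simp add: kill_at_def)
qed

lemma shift_vs_b_run:
  assumes "shift x" "b_run q" shows "q \<le> x - 1 \<or> x + k - 1 \<le> q"
proof (rule ccontr)
  assume "\<not> ?thesis"
  then have "w (x - 1) = B" using assms(2) k4 by (auto simp: run_end_def)
  then show False using assms(1) by (simp add: shift_at_def)
qed

lemma shift_vs_a_run:
  assumes "shift x" "a_run q" shows "q \<le> x - k \<or> x + k - 2 \<le> q"
  using a_run_b_run[OF assms(2) shift_b_run[OF assms(1)]] by linarith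

lemma shift_shift:
  assumes "shift x" "shift x'" "x < x'" shows "x + k \<le> x'"
  using shift_vs_b_run[OF assms(1) shift_b_run[OF assms(2)]] assms(3) by linarith

lemma kill_kill:
  assumes "kill z" "kill z'" "z < z'" shows "z + k \<le> z'"
  using kill_vs_a_run[OF assms(2) kill_a_run[OF assms(1)]] assms(3) by linarith

text \<open>At \<open>x + k - 1\<close> the \<open>b\<close> opening the kill word would have to be
  the \<open>a\<close> closing the shift word. At \<open>x + k - 2\<close> the two words overlap
  consistently in \<open>ba\<close>; this one exception drives the tight cycle.\<close>

lemma shift_kill:
  assumes "shift x" "kill z" shows "z \<le> x - k \<or> z = x + k - 2 \<or> x + k \<le> z"
proof -
  have "z \<noteq> x + k - 1"
  proof
    assume "z = x + k - 1"
    then have "z - k = x - 1" by simp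
    then show False using assms by (simp add: kill_at_def shift_at_def)
  qed
  then show ?thesis using shift_vs_a_run[OF assms(1) kill_a_run[OF assms(2)]] by linarith
qed

lemma b_run_kill_shift:
  assumes "b_run y" "kill (y + k - 1)" shows "shift (y + 1)"
proof -
  have "w y = A" using assms(2) k4 by (auto simp: run_end_def kill_at_def)
  then show ?thesis using assms(1) by (simp add: shift_at_def)
qed

lemma keep:
  assumes "r p" "0 \<le> p" "\<not> kill (p + k)" "shift (p + k) \<Longrightarrow> r (p + 1)"
  shows "r (p + k)"
\<comment> \<open>At a shift the long block is forbidden, but no run of equal letters ends there, so
  the short block from \<open>p + 1\<close> is available.\<close>
proof (cases "shift (p + k)")
  case True
  then have "\<not> a_run (p + k)" "\<not> b_run (p + k)"
    using shift_vs_a_run[of "p+k" "p+k"] shift_vs_b_run[of "p+k" "p+k"] k4 by auto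
  then show ?thesis using rec[of "p + k"] assms True by simp
next
  case False
  then show ?thesis using rec[of "p + k"] assms by simp
qed

lemma fill:
  assumes "r (p + 1)" "0 \<le> p" "\<not> a_run (p + k)" "\<not> b_run (p + k)"
  shows "r (p + k)"
  using rec[of "p + k"] assms by simp

lemma kill_zero: "k \<le> p \<Longrightarrow> kill p \<Longrightarrow> \<not> r p"
  using rec[of p] kill_a_run by blast

section \<open>Counting reachable cuts in a window\<close>

definition ones :: "int \<Rightarrow> int \<Rightarrow> int" where
  "ones a b = int (card ({a..b} \<inter> Collect r))"

lemma ones_mono: "a \<le> a' \<Longrightarrow> b' \<le> b \<Longrightarrow> ones a' b' \<le> ones a b"
  unfolding ones_def by (intro of_nat_mono card_mono) auto

lemma ones_split:
  assumes "a \<le> c" "c \<le> b + 1" shows "ones a b = ones a (c - 1) + ones c b"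
proof -
  have "{a..b} \<inter> Collect r = ({a..c - 1} \<inter> Collect r) \<union> ({c..b} \<inter> Collect r)"
    using assms by auto
  moreover have "card \<dots> = card ({a..c - 1} \<inter> Collect r) + card ({c..b} \<inter> Collect r)"
    by (rule card_Un_disjoint) auto
  ultimately show ?thesis by (simp add: ones_def)
qed

lemma ones_single: "ones a a = (if r a then 1 else 0)"
proof -
  have "{a..a} \<inter> Collect r = (if r a then {a} else {})" by auto
  then show ?thesis by (simp add: ones_def)
qed

lemma ones_Cons: "a \<le> b \<Longrightarrow> ones a b = (if r a then 1 else 0) + ones (a + 1) b"
  using ones_split[of a "a + 1" b] ones_single[of a] by simp

lemma ones_snoc: "a \<le> b \<Longrightarrow> ones a b = ones a (b - 1) + (if r b then 1 else 0)"
  using ones_split[of a b b] ones_single[of b] by simp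

lemma ones_le:
  assumes "a \<le> b + 1" shows "ones a b \<le> b - a + 1"
proof -
  have "card ({a..b} \<inter> Collect r) \<le> card {a..b}" by (intro card_mono) auto
  then show ?thesis using assms by (simp add: ones_def)
qed

lemma ones_eq_length_iff:
  assumes "a \<le> b + 1" shows "ones a b = b - a + 1 \<longleftrightarrow> (\<forall>p. a \<le> p \<and> p \<le> b \<longrightarrow> r p)"
proof
  assume *: "ones a b = b - a + 1"
  have "card ({a..b} \<inter> Collect r) = card {a..b}" using * assms by (simp add: ones_def)
  then have "{a..b} \<inter> Collect r = {a..b}" by (intro card_subset_eq) auto
  then have "{a..b} \<subseteq> Collect r" by blast
  then show "\<forall>p. a \<le> p \<and> p \<le> b \<longrightarrow> r p" by (simp add: subset_iff)
next
  assume *: "\<forall>p. a \<le> p \<and> p \<le> b \<longrightarrow> r p"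
  then have "{a..b} \<inter> Collect r = {a..b}" by auto
  then show "ones a b = b - a + 1" using assms by (simp add: ones_def)
qed

lemma ones_pos: "0 < ones a b \<longleftrightarrow> (\<exists>p. a \<le> p \<and> p \<le> b \<and> r p)"
  unfolding ones_def of_nat_0_less_iff card_gt_0_iff by auto

text \<open>Translation by \<open>k\<close> is injective: \<open>Z\<close> collects the cuts that
  may be lost, \<open>F\<close> the holes that are filled.\<close>

lemma ones_shift:
  assumes "finite Z" "\<And>p. a \<le> p \<Longrightarrow> p \<le> b \<Longrightarrow> r p \<Longrightarrow> p \<notin> Z \<Longrightarrow> r (p + k)"
    and "\<And>p. p \<in> F \<Longrightarrow> a \<le> p \<and> p \<le> b \<and> \<not> r p \<and> r (p + k)"
  shows "ones a b - int (card Z) + int (card F) \<le> ones (a + k) (b + k)"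
proof -
  let ?P = "{a..b} \<inter> Collect r"
  have F: "finite F" by (rule finite_subset[of _ "{a..b}"]) (use assms(3) in auto)
  have "card ((?P - Z) \<union> F) = card (?P - Z) + card F"
    by (rule card_Un_disjoint) (use F assms(3) in auto)
  moreover have "card ?P - card Z \<le> card (?P - Z)"
    using diff_card_le_card_Diff[OF assms(1)] by simp
  moreover have "card ((\<lambda>p. p + k) ` ((?P - Z) \<union> F)) = card ((?P - Z) \<union> F)"
    by (rule card_image) (auto simp: inj_on_def)
  moreover have "card ((\<lambda>p. p + k) ` ((?P - Z) \<union> F)) \<le> card ({a + k..b + k} \<inter> Collect r)"
    by (rule card_mono) (use assms in auto)
  ultimately show ?thesis unfolding ones_def by linarith
qed

text \<open>At such an ascent \<open>fill\<close> can create a new cut one revolution later; this is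
  the usual compensation for a lost one.\<close>

lemma step_up:
  assumes "a \<le> b" "\<not> r a" "r b" shows "\<exists>p. a \<le> p \<and> p < b \<and> \<not> r p \<and> r (p + 1)"
  using assms
proof (induction b rule: int_ge_induct)
  case (step b)
  then show ?case by (cases "r b") force+
qed simp

text \<open>The word of either event, ending in this range, would begin with a \<open>b\<close>
  inside the run of \<open>a\<close>.\<close>

lemma quiet_after_a_run:
  assumes "a_run y" "y < p" "p < y + k" shows "\<not> kill p" "\<not> shift p"
  using kill_vs_a_run[of p y] shift_vs_a_run[of p y] assms k4 by fastforce+

lemma quiet_after_shift:
  assumes "shift x" "x < p" "p < x + k - 2"
  shows "\<not> a_run p" "\<not> b_run p" "\<not> kill p" "\<not> shift p"
  using shift_vs_a_run[of x p] shift_vs_b_run[of x p] shift_shift[of x p] kill_a_run[of p] assms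
  by fastforce+

lemma quiet_before_kill:
  assumes "kill z" "z - k + 1 < p" "p < z"
  shows "\<not> a_run p" "\<not> b_run p"
  using kill_vs_a_run[of z p] a_run_b_run[OF kill_a_run, of z p] assms by fastforce+

lemma a_run_keeps_ones:
  assumes "a_run y" "0 \<le> a" "y < a + k" "b < y"
  shows "ones a b \<le> ones (a + k) (b + k)"
proof -
  have "r (p + k)" if "a \<le> p" "p \<le> b" "r p" for p
    using quiet_after_a_run[OF assms(1), of "p + k"] that assms by (intro keep) auto
  then show ?thesis using ones_shift[of "{}" a b "{}"] by simp
qed

text \<open>A window of length \<open>k - 2\<close> loses a cut during one revolution only if a kill hits it (then its left
  end grows) or if a shift hits the end of a run while the left end is held by a run of \<open>b\<close>.\<close>

lemma revolution:
  assumes s: "1 \<le> s" "r s"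
  obtains
    (stay) "ones s (s + k - 3) \<le> ones (s + k) (s + 2 * k - 3)"
  | (grow) "ones s (s + k - 3) \<le> ones (s + k - 1) (s + 2 * k - 4)"
  | (kill) z where "kill z" "s + k \<le> z" "z \<le> s + 2 * k - 3" "r (z - k)"
      "ones s (s + k - 3) \<le> ones (s + k - 1) (s + 2 * k - 3)"
  | (shift) x where "b_run (s + k - 1)" "shift x" "s + k \<le> x" "x \<le> s + 2 * k - 3"
      "ones s (s + k - 3) \<le> ones (s + k) (x - 1) + 1"
proof -
  \<comment> \<open>The position just left of the translated window. The short block from
    \<open>s\<close> reaches it unless a run ends there, so it decides whether the left end
    grows.\<close>
  define y where "y = s + k - 1"
  have e: "s + k - 3 + k = s + 2 * k - 3" by simp
  consider (a) "a_run y" | (k) z where "\<not> a_run y" "kill z" "s + k \<le> z" "z \<le> s + 2 * k - 3"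
    | (n) "\<not> a_run y" "\<And>z. kill z \<Longrightarrow> s + k \<le> z \<Longrightarrow> z \<le> s + 2 * k - 3 \<Longrightarrow> False"
    by blast
  then show thesis
  proof cases
    case a
    then show thesis
      using a_run_keeps_ones[of y s "s + k - 3", unfolded e] s k4 stay by (simp add: y_def)
  next
    case k
    have "\<not> b_run y"
      using a_run_b_run[OF kill_a_run[OF k(2)], of y] k k4 by (auto simp: y_def)
    then have ry: "r y" using fill[of "s - 1"] s k(1) by (simp add: y_def add.commute add_diff_eq)
    have noshift: "\<not> shift p" if "s + k \<le> p" "p \<le> s + 2 * k - 3" for p
      using shift_kill[of p z] k that k4 by fastforce
    have keeps: "r (p + k)" if "s \<le> p" "p \<le> s + k - 3" "r p" "p \<noteq> z - k" for p
    proof (rule keep)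
      show "\<not> kill (p + k)" using kill_kill[of "p + k" z] kill_kill[of z "p + k"] k that s by fastforce
    qed (use noshift[of "p + k"] that s in auto)
    show thesis
    proof (cases "r (z - k)")
      case True
      have "ones s (s + k - 3) - 1 \<le> ones (s + k) (s + 2 * k - 3)"
        using ones_shift[of "{z - k}" s "s + k - 3" "{}"] keeps e by simp
      moreover have "ones y (s + 2 * k - 3) = 1 + ones (s + k) (s + 2 * k - 3)"
        using ones_Cons[of y "s + 2 * k - 3"] ry k4 by (simp add: y_def)
      ultimately show thesis using kill[of z] k True by (simp add: y_def)
    next
      case False
      then have "ones s (s + k - 3) \<le> ones (s + k) (s + 2 * k - 3)"
        using ones_shift[of "{}" s "s + k - 3" "{}"] keeps e by auto
      then show thesis by (rule stay)
    qed
  next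
    case n
    have nokill: "\<not> kill (p + k)" if "s \<le> p" "p \<le> s + k - 3" for p
      using n(2)[of "p + k"] that by auto
    show thesis
    \<comment> \<open>A shift at \<open>x\<close> loses a cut only if \<open>x - k\<close> is
      reachable and its right neighbour is not.\<close>
    proof (cases "\<exists>x. shift x \<and> s + k \<le> x \<and> x \<le> s + 2 * k - 3 \<and> r (x - k) \<and> \<not> r (x - k + 1)")
      case False
      have "r (p + k)" if "s \<le> p" "p \<le> s + k - 3" "r p" for p
      proof (rule keep)
        show "r (p + 1)" if "shift (p + k)"
          using False that \<open>s \<le> p\<close> \<open>p \<le> s + k - 3\<close> \<open>r p\<close>
          by (metis add_diff_cancel_right' add_le_cancel_right e)
      qed (use that s nokill in auto)
      then show thesis using ones_shift[of "{}" s "s + k - 3" "{}"] e stay by simp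
    next
      case True
      then obtain x where x: "shift x" "s + k \<le> x" "x \<le> s + 2 * k - 3" "r (x - k)" "\<not> r (x - k + 1)"
        by blast
      have keeps: "r (p + k)" if "s \<le> p" "p \<le> s + k - 3" "r p" "p \<noteq> x - k" for p
      proof (rule keep)
        show "r (p + 1)" if "shift (p + k)"
          using shift_shift[of "p + k" x] shift_shift[of x "p + k"] that x \<open>p \<noteq> x - k\<close> \<open>s \<le> p\<close>
            \<open>p \<le> s + k - 3\<close> by fastforce
      qed (use that s nokill in auto)
      show thesis
      \<comment> \<open>An ascent to the right of the lost cut is filled and pays for it. Otherwise
        \<open>x - k\<close> is the last cut of the window.\<close>
      proof (cases "\<exists>p. x - k + 1 \<le> p \<and> p < s + k - 3 \<and> \<not> r p \<and> r (p + 1)")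
        case True
        then obtain p where p: "x - k + 1 \<le> p" "p < s + k - 3" "\<not> r p" "r (p + 1)" by blast
        have "r (p + k)"
          using quiet_after_shift[OF x(1), of "p + k"] p x s k4 by (intro fill) auto
        then show thesis
          using ones_shift[of "{x - k}" s "s + k - 3" "{p}"] keeps e p x(2) stay by simp
      next
        case False
        then have zero: "\<not> r p" if "x - k + 1 \<le> p" "p \<le> s + k - 3" for p
          using step_up[of "x - k + 1" p] x(5) that by fastforce
        have "ones (x - k + 1) (s + k - 3) = 0"
          using ones_pos[of "x - k + 1" "s + k - 3"] zero by (auto simp: ones_def)
        then have "ones s (s + k - 3) = ones s (x - k - 1) + 1"
          using ones_split[of s "x - k + 1" "s + k - 3"] ones_snoc[of s "x - k"] x by simp
        moreover have "ones s (x - k - 1) \<le> ones (s + k) (x - 1)"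
          using ones_shift[of "{}" s "x - k - 1" "{}"] keeps x by simp
        ultimately have *: "ones s (s + k - 3) \<le> ones (s + k) (x - 1) + 1" by simp
        show thesis
        proof (cases "r y")
          case True
          have "ones y (x - 1) = 1 + ones (s + k) (x - 1)"
            using ones_Cons[of y "x - 1"] True x by (simp add: y_def)
          moreover have "ones y (x - 1) \<le> ones y (s + 2 * k - 4)"
            using x by (intro ones_mono) auto
          ultimately show thesis using grow * by (simp add: y_def)
        next
          case False
          then have "b_run y" using fill[of "s - 1"] s n(1) by (auto simp: y_def add.commute add_diff_eq)
          then show thesis using shift x * by (simp add: y_def)
        qed
      qed
    qed
  qed
qed

end

section \<open>The lower bound\<close>

text \<open>For an uncompletable word of length \<open>L\<close>, no cut can lie so late that the
  rest of the word fits into one padded block.\<close>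

locale vanishing_cuts = cut_recurrence +
  fixes L :: int
  assumes bounded: "0 \<le> p \<Longrightarrow> r p \<Longrightarrow> p + k \<le> L"
begin

text \<open>In the tight cycle the right end of a run advances by \<open>5 * k - 4\<close> while the
  run loses one cut, so its left end, from which windows are measured, advances by
  \<open>5 * k - 3\<close>.\<close>

definition weight :: "int \<Rightarrow> int" where
  "weight n = (5 * k - 3) * n"

lemma weight_1: "weight 1 = 5 * k - 3"
  by (simp add: weight_def)

lemma weight_plus1: "weight (n + 1) = weight n + 5 * k - 3"
  by (simp add: weight_def algebra_simps)

lemma weight_minus1: "weight (n - 1) = weight n - 5 * k + 3"
  by (simp add: weight_def algebra_simps)

lemma weight_mono: "m \<le> n \<Longrightarrow> weight m \<le> weight n"
  using k4 by (simp add: weight_def mult_left_mono)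

text \<open>The constants below form a potential: in each transition from one shape to the shape reached
  one revolution later, the bound changes by no more than the distance between the two windows. Along
  the tight cycle \<open>gap_kill\<close>, \<open>gap\<close>, \<open>gap_shift\<close>, \<open>lone_end\<close>, \<open>shifted\<close>, \<open>gap_kill\<close> there is no slack
  at all.\<close>

definition wide :: "int \<Rightarrow> bool" where
  "wide s \<longleftrightarrow> (0 < ones s (s + k - 2) \<longrightarrow> s + weight (ones s (s + k - 2)) - 10 * k + 9 \<le> L)"

definition narrow :: "int \<Rightarrow> bool" where
  "narrow s \<longleftrightarrow> (0 < ones s (s + k - 3) \<longrightarrow> s + weight (ones s (s + k - 3)) - 9 * k + 8 \<le> L)"

text \<open>The count \<open>k - 2\<close> is excluded because the run, once grown by one, would not
  fit the window of \<open>gap\<close>; that case is \<open>full_gap_shift\<close>, with a weaker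
  constant.\<close>

definition shifted :: "int \<Rightarrow> bool" where
  "shifted s \<longleftrightarrow> (\<forall>x. shift x \<longrightarrow> s < x \<longrightarrow> x \<le> s + k - 2 \<longrightarrow> 0 < ones s (x - 1) \<longrightarrow>
     ones s (x - 1) \<le> k - 3 \<longrightarrow> s + weight (ones s (x - 1)) - 5 * k + 5 \<le> L)"

definition killed :: "int \<Rightarrow> bool" where
  "killed s \<longleftrightarrow> (\<forall>z. r s \<longrightarrow> kill z \<longrightarrow> \<not> r z \<longrightarrow> s < z \<longrightarrow> z \<le> s + k - 3 \<longrightarrow>
     s + weight (ones s (s + k - 3)) - 8 * k + 7 \<le> L)"

text \<open>The last cut is cut off from its run at \<open>q\<close>, which is not counted. Asking
  for \<open>a_run q\<close> instead of \<open>kill q\<close> lets the shape reproduce itself while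
  a long run of \<open>a\<close> continues.\<close>

definition lone_end :: "int \<Rightarrow> bool" where
  "lone_end s \<longleftrightarrow> (\<forall>q. s < q \<longrightarrow> q \<le> s + k - 4 \<longrightarrow> (\<forall>p. s \<le> p \<and> p < q \<longrightarrow> r p) \<longrightarrow> r (q + 1) \<longrightarrow>
     a_run q \<longrightarrow> s + weight (q - s + 1) - 4 * k + 4 \<le> L)"

definition one_hole :: "int \<Rightarrow> bool" where
  "one_hole s \<longleftrightarrow> (\<forall>q. s < q \<longrightarrow> q < s + k - 2 \<longrightarrow>
     (\<forall>p. s \<le> p \<and> p \<le> s + k - 2 \<and> p \<noteq> q \<longrightarrow> r p) \<longrightarrow>
     a_run q \<longrightarrow> s + weight (k - 2) - 7 * k + 7 \<le> L)"

definition gap :: "int \<Rightarrow> bool" where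
  "gap s \<longleftrightarrow> (\<forall>e. s \<le> e \<longrightarrow> e \<le> s + k - 3 \<longrightarrow> (\<forall>p. s \<le> p \<and> p \<le> e \<longrightarrow> r p) \<longrightarrow>
     s + weight (e - s + 1) - 7 * k + 6 \<le> L)"

definition gap_kill :: "int \<Rightarrow> bool" where
  "gap_kill s \<longleftrightarrow> (\<forall>e. s \<le> e \<longrightarrow> e \<le> s + k - 3 \<longrightarrow> (\<forall>p. s \<le> p \<and> p \<le> e \<longrightarrow> r p) \<longrightarrow>
     kill (e + 1) \<longrightarrow> s + weight (e - s + 1) - 6 * k + 6 \<le> L)"

definition gap_shift :: "int \<Rightarrow> bool" where
  "gap_shift s \<longleftrightarrow> (\<forall>e. s \<le> e \<longrightarrow> e \<le> s + k - 4 \<longrightarrow> (\<forall>p. s \<le> p \<and> p \<le> e \<longrightarrow> r p) \<longrightarrow>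
     shift (e + 1) \<longrightarrow> s + weight (e - s + 1) - 3 * k + 3 \<le> L)"

definition full_gap_shift :: "int \<Rightarrow> bool" where
  "full_gap_shift s \<longleftrightarrow> ((\<forall>p. s \<le> p \<and> p \<le> s + k - 3 \<longrightarrow> r p) \<longrightarrow>
     shift (s + k - 2) \<longrightarrow> s + weight (k - 2) - 6 * k + 6 \<le> L)"

definition invariants :: "int \<Rightarrow> bool" where
  "invariants s \<longleftrightarrow> wide s \<and> narrow s \<and> shifted s \<and> killed s \<and> lone_end s \<and> one_hole s \<and>
     gap s \<and> gap_kill s \<and> gap_shift s \<and> full_gap_shift s"

section \<open>Applying the potential bounds\<close>

lemma wideD:
  assumes "wide s" "0 < m" "m \<le> ones a b" "s \<le> a" "b \<le> s + k - 2"
  shows "s + weight m - 10 * k + 9 \<le> L"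
proof -
  have "ones a b \<le> ones s (s + k - 2)" using assms by (intro ones_mono)
  then show ?thesis
    using assms weight_mono[of m "ones s (s + k - 2)"] by (simp add: wide_def)
qed

lemma narrowD:
  assumes "narrow s" "0 < m" "m \<le> ones a b" "s \<le> a" "b \<le> s + k - 3"
  shows "s + weight m - 9 * k + 8 \<le> L"
proof -
  have "ones a b \<le> ones s (s + k - 3)" using assms by (intro ones_mono)
  then show ?thesis
    using assms weight_mono[of m "ones s (s + k - 3)"] by (simp add: narrow_def)
qed

lemma ones_full: "(\<And>p. a \<le> p \<Longrightarrow> p \<le> b \<Longrightarrow> r p) \<Longrightarrow> a \<le> b + 1 \<Longrightarrow> ones a b = b - a + 1"
  using ones_eq_length_iff[of a b] by simp

lemma gapD:
  assumes "gap s" "s \<le> e" "e \<le> s + k - 3" "\<And>p. s \<le> p \<Longrightarrow> p \<le> e \<Longrightarrow> r p" "e - s + 1 = n"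
  shows "s + weight n - 7 * k + 6 \<le> L"
  using assms unfolding gap_def by blast

lemma gap_killD:
  assumes "gap_kill s" "kill z" "s < z" "z \<le> s + k - 2" "\<And>p. s \<le> p \<Longrightarrow> p < z \<Longrightarrow> r p" "z - s = n"
  shows "s + weight n - 6 * k + 6 \<le> L"
proof -
  have "s \<le> z - 1" "z - 1 \<le> s + k - 3" "kill (z - 1 + 1)" "z - 1 - s + 1 = n" using assms by auto
  then show ?thesis using assms(1,5) unfolding gap_kill_def by (metis zle_diff1_eq)
qed

lemma one_holeD:
  assumes "one_hole s" "s < q" "q < s + k - 2" "\<And>p. s \<le> p \<Longrightarrow> p \<le> s + k - 2 \<Longrightarrow> p \<noteq> q \<Longrightarrow> r p" "a_run q"
  shows "s + weight (k - 2) - 7 * k + 7 \<le> L"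
  using assms unfolding one_hole_def by blast

lemma lone_endD:
  assumes "lone_end s" "s < q" "q \<le> s + k - 4" "\<And>p. s \<le> p \<Longrightarrow> p < q \<Longrightarrow> r p" "r (q + 1)" "a_run q" "q - s + 1 = n"
  shows "s + weight n - 4 * k + 4 \<le> L"
  using assms unfolding lone_end_def by blast

lemma shiftedD:
  assumes "shifted s" "shift x" "s < x" "x \<le> s + k - 2" "0 < m" "m \<le> ones s (x - 1)" "ones s (x - 1) \<le> k - 3"
  shows "s + weight m - 5 * k + 5 \<le> L"
  using assms weight_mono[of m "ones s (x - 1)"] by (fastforce simp: shifted_def)

lemma gap_shiftD:
  assumes "gap_shift s" "shift z" "s < z" "z \<le> s + k - 3" "\<And>p. s \<le> p \<Longrightarrow> p < z \<Longrightarrow> r p" "z - s = n"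
  shows "s + weight n - 3 * k + 3 \<le> L"
proof -
  have "s \<le> z - 1" "z - 1 \<le> s + k - 4" "shift (z - 1 + 1)" "z - 1 - s + 1 = n" using assms by auto
  then show ?thesis using assms(1,5) unfolding gap_shift_def by (metis zle_diff1_eq)
qed

lemma full_gap_shiftD:
  assumes "full_gap_shift s" "x = s + k - 2" "\<And>p. s \<le> p \<Longrightarrow> p < x \<Longrightarrow> r p" "shift x"
  shows "s + weight (k - 2) - 6 * k + 6 \<le> L"
  using assms by (simp add: full_gap_shift_def)

section \<open>One revolution from each shape\<close>

lemma gap_killI:
  assumes "1 \<le> s" and later: "\<And>s'. s < s' \<Longrightarrow> invariants s'"
  shows "gap_kill s"
  unfolding gap_kill_def
proof (intro allI impI)
  fix e assume e: "s \<le> e" "e \<le> s + k - 3" "\<forall>p. s \<le> p \<and> p \<le> e \<longrightarrow> r p" "kill (e + 1)"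
  \<comment> \<open>The run of \<open>a\<close> ending at the kill excludes further events for a
    whole revolution, so the run of cuts is translated intact.\<close>
  have "r p" if "s + k \<le> p" "p \<le> e + k" for p
    using keep[of "p - k"] quiet_after_a_run[OF kill_a_run[OF e(4)], of p] e that assms(1) k4 by auto
  moreover have "gap (s + k)" using later[of "s + k"] k4 by (simp add: invariants_def)
  ultimately have "s + k + weight (e + k - (s + k) + 1) - 7 * k + 6 \<le> L"
    using e unfolding gap_def by (elim allE[of _ "e + k"]) auto
  then show "s + weight (e - s + 1) - 6 * k + 6 \<le> L" by simp
qed

lemma gapI:
  assumes s: "1 \<le> s" and later: "\<And>s'. s < s' \<Longrightarrow> invariants s'"
  shows "gap s"
  unfolding gap_def
proof (intro allI impI)
  fix e assume e: "s \<le> e" "e \<le> s + k - 3" and full: "\<forall>p. s \<le> p \<and> p \<le> e \<longrightarrow> r p"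
  define y where "y = s + k - 1"
  define W where "W = weight (e - s + 1)"
  have W1: "weight (e - s) = W - 5 * k + 3" using weight_minus1[of "e - s + 1"] by (simp add: W_def)
  \<comment> \<open>Two ways on: in \<open>gapk\<close> the whole run survives; in
    \<open>gapy\<close> it loses its right end but gains \<open>y\<close> on the left.\<close>
  have gapk: "s + W - 6 * k + 6 \<le> L" if "\<And>p. s + k \<le> p \<Longrightarrow> p \<le> e + k \<Longrightarrow> r p"
    using that later[of "s + k"] k4 e unfolding invariants_def gap_def W_def
    by (auto elim!: allE[of _ "e + k"])
  have gapy: "s + k - 1 + W - 7 * k + 6 \<le> L" if "\<And>p. y \<le> p \<Longrightarrow> p \<le> e + k - 1 \<Longrightarrow> r p"
  proof -
    have "gap y" using later[of y] k4 by (simp add: invariants_def y_def)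
    then have "y + weight (e + k - 1 - y + 1) - 7 * k + 6 \<le> L"
      using that e unfolding gap_def by (elim allE[of _ "e + k - 1"]) (auto simp: y_def)
    then show ?thesis by (simp add: W_def y_def)
  qed
  have inside: "r (p + k)" if "s \<le> p" "p < e" "\<not> kill (p + k)" for p
    using keep[of p] that full s by simp
  show "s + weight (e - s + 1) - 7 * k + 6 \<le> L"
  proof (cases "\<exists>z. kill z \<and> y \<le> z \<and> z \<le> e + k")
    case False
    then have nokill: "\<not> kill p" if "y \<le> p" "p \<le> e + k" for p
      using that by blast
    then have in': "r (p + k)" if "s \<le> p" "p < e" for p
      using inside[of p] that by (simp add: y_def)
    show ?thesis
    proof (cases "r (e + k)")
      case True
      have "s + W - 6 * k + 6 \<le> L"
      proof (rule gapk)
        fix p assume "s + k \<le> p" "p \<le> e + k"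
        then show "r p" using in'[of "p - k"] True by (cases "p = e + k") auto
      qed
      then show ?thesis using k4 by (simp add: W_def)
    next
      case False': False
      then have sh: "shift (e + k)" using keep[of e] nokill[of "e + k"] full e s by (auto simp: y_def)
      show ?thesis
      proof (cases "r y")
        case True
        have "s + k - 1 + W - 7 * k + 6 \<le> L"
        proof (rule gapy)
          fix p assume "y \<le> p" "p \<le> e + k - 1"
          then show "r p" using in'[of "p - k"] True by (cases "p = y") (auto simp: y_def)
        qed
        then show ?thesis using k4 by (simp add: W_def)
      next
        case ry: False
        show ?thesis
        proof (cases "e = s")
          case True
          then show ?thesis using bounded[of s] full s k4 by (simp add: weight_1)
        next
          case ne: False
          \<comment> \<open>The tight case: the right end falls to the shift and the left end does
            not grow.\<close>
          have "gap_shift (s + k)" using later[of "s + k"] k4 by (simp add: invariants_def)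
          moreover have "r p" if "s + k \<le> p" "p \<le> e + k - 1" for p
            using in'[of "p - k"] that by auto
          ultimately have "s + k + weight (e + k - 1 - (s + k) + 1) - 3 * k + 3 \<le> L"
            using sh e ne unfolding gap_shift_def by (elim allE[of _ "e + k - 1"]) auto
          then show ?thesis using W1 k4 by (simp add: W_def)
        qed
      qed
    qed
  next
    case True
    then obtain z where z: "kill z" "y \<le> z" "z \<le> e + k" by blast
    have nokill: "\<not> kill p" if "y \<le> p" "p \<le> e + k" "p \<noteq> z" for p
      using kill_kill[of p z] kill_kill[of z p] z that e by (fastforce simp: y_def)
    show ?thesis
    proof (cases "z = y")
      case True
      \<comment> \<open>A kill at \<open>y\<close> stops the left end from growing but hits no
        translated cut.\<close>
      have "s + W - 6 * k + 6 \<le> L"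
      proof (rule gapk)
        fix p assume "s + k \<le> p" "p \<le> e + k"
        then show "r p"
          using keep[of "p - k"] quiet_after_a_run[OF kill_a_run[OF z(1)], of p] full s e True
          by (auto simp: y_def)
      qed
      then show ?thesis using k4 by (simp add: W_def)
    next
      case ne: False
      have "\<not> a_run y" using kill_vs_a_run[OF z(1), of y] z ne e by (auto simp: y_def)
      moreover have "\<not> b_run y" using a_run_b_run[OF kill_a_run[OF z(1)], of y] z ne e k4 by (auto simp: y_def)
      ultimately have ry: "r y" using fill[of "s - 1"] s full e by (simp add: y_def add.commute add_diff_eq)
      show ?thesis
      proof (cases "z = e + k")
        case True
        have "s + k - 1 + W - 7 * k + 6 \<le> L"
        proof (rule gapy)
          fix p assume "y \<le> p" "p \<le> e + k - 1"
          then show "r p" using inside[of "p - k"] nokill[of p] ry True by (cases "p = y") (auto simp: y_def)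
        qed
        then show ?thesis using k4 by (simp add: W_def)
      next
        case ne': False
        have nosh: "\<not> shift (e + k)" using shift_kill[of "e + k" z] z ne ne' e by (auto simp: y_def)
        have all: "r p" if "y \<le> p" "p \<le> e + k" "p \<noteq> z" for p
        proof (cases "p = y")
          case False
          then show ?thesis using keep[of "p - k"] nokill[of p] nosh full that s
            by (cases "p = e + k") (auto simp: y_def)
        qed (simp add: ry)
        \<comment> \<open>The kill makes a hole strictly inside the grown run. If that run spans
          \<open>k - 1\<close> positions it is treated by \<open>one_hole\<close>, otherwise by
          \<open>killed\<close>.\<close>
        show ?thesis
        proof (cases "e = s + k - 3")
          case True
          have "one_hole y" using later[of y] k4 by (simp add: invariants_def y_def)
          moreover have "r p" if "y \<le> p" "p \<le> y + k - 2" "p \<noteq> z" for p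
            using all[of p] that True by (simp add: y_def)
          moreover have "y < z" "z < y + k - 2" using z ne ne' True by (auto simp: y_def)
          ultimately have "y + weight (k - 2) - 7 * k + 7 \<le> L"
            using kill_a_run[OF z(1)] by (intro one_holeD[of y z])
          then show ?thesis using True k4 by (simp add: y_def)
        next
          case False
          have "killed y" using later[of y] k4 by (simp add: invariants_def y_def)
          moreover have "\<not> r z" using kill_zero[OF _ z(1)] z(2) s by (simp add: y_def)
          ultimately have *: "y + weight (ones y (y + k - 3)) - 8 * k + 7 \<le> L"
            using ry z ne ne' e False unfolding killed_def by (elim allE[of _ z]) (auto simp: y_def)
          have "ones y (z - 1) = z - y" using ones_eq_length_iff[of y "z - 1"] all z by auto
          moreover have "ones (z + 1) (e + k) = e + k - z"
            using ones_eq_length_iff[of "z + 1" "e + k"] all z by auto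
          moreover have "ones y (e + k) = ones y (z - 1) + ones z (e + k)"
            using ones_split[of y z "e + k"] z by simp
          moreover have "ones z (e + k) \<ge> ones (z + 1) (e + k)" by (rule ones_mono) auto
          moreover have "ones y (e + k) \<le> ones y (y + k - 3)"
            using e False by (intro ones_mono) (auto simp: y_def)
          ultimately have "e - s + 1 \<le> ones y (y + k - 3)" by (simp add: y_def)
          then have "W \<le> weight (ones y (y + k - 3))" unfolding W_def by (rule weight_mono)
          then show ?thesis using * k4 by (simp add: W_def y_def)
        qed
      qed
    qed
  qed
qed

lemma killedI:
  assumes s: "1 \<le> s" and later: "\<And>s'. s < s' \<Longrightarrow> invariants s'"
  shows "killed s"
  unfolding killed_def
proof (intro allI impI)
  fix z assume z: "r s" "kill z" "\<not> r z" "s < z" "z \<le> s + k - 3"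
  let ?n = "ones s (s + k - 3)"
  have n: "0 < ?n" using ones_pos[of s "s + k - 3"] z(1) k4 by force
  have later_narrow: "narrow s'" if "s < s'" for s' using later[OF that] by (simp add: invariants_def)
  have stay: "s + weight ?n - 8 * k + 7 \<le> L" if "?n \<le> ones (s + k) (s + 2 * k - 3)"
    using narrowD[OF later_narrow n that, of "s + k"] k4 by simp
  show "s + weight ?n - 8 * k + 7 \<le> L"
  proof (cases rule: revolution[OF s z(1)])
    case 1
    then show ?thesis by (rule stay)
  next
    case 2
    then show ?thesis using narrowD[OF later_narrow n 2, of "s + k - 1"] k4 by simp
  next
    \<comment> \<open>The position killed at \<open>z\<close> is a hole to the left of the next
      victim \<open>z2 - k\<close>; an ascent between them is filled and pays for it.\<close>
    case (3 z2)
    have "z + k \<le> z2" using kill_kill[of z z2] z 3 k4 by linarith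
    then have "z < z2 - k" using z(3) 3(4) by (cases "z = z2 - k") auto
    then obtain p where p: "z \<le> p" "p < z2 - k" "\<not> r p" "r (p + 1)"
      using step_up[of z "z2 - k"] z(3) 3(4) by auto
    have "r (p + k)"
      using quiet_before_kill[OF 3(1), of "p + k"] p z 3 s by (intro fill) auto
    moreover have "r (i + k)" if "s \<le> i" "i \<le> s + k - 3" "r i" "i \<noteq> z2 - k" for i
    proof (rule keep)
      show "\<not> kill (i + k)" using kill_kill[of "i + k" z2] kill_kill[of z2 "i + k"] 3 that s by fastforce
      show "r (i + 1)" if "shift (i + k)"
        using shift_kill[OF that 3(1)] 3 \<open>s \<le> i\<close> \<open>i \<le> s + k - 3\<close> by linarith
    qed (use that s in auto)
    moreover have e: "s + k - 3 + k = s + 2 * k - 3" by simp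
    ultimately have "?n \<le> ones (s + k) (s + 2 * k - 3)"
      using ones_shift[of "{z2 - k}" s "s + k - 3" "{p}", unfolded e] p z 3 by simp
    then show ?thesis by (rule stay)
  next
    case (4 x)
    then show ?thesis using a_run_b_run[OF kill_a_run[OF z(2)], of "s + k - 1"] z k4 by linarith
  qed
qed

lemma lone_endI:
  assumes s: "1 \<le> s" and later: "\<And>s'. s < s' \<Longrightarrow> invariants s'"
  shows "lone_end s"
  unfolding lone_end_def
proof (intro allI impI)
  fix q assume q: "s < q" "q \<le> s + k - 4" and full: "\<forall>p. s \<le> p \<and> p < q \<longrightarrow> r p"
    and end_one: "r (q + 1)" and run: "a_run q"
  define y where "y = s + k - 1"
  define n where "n = q - s + 1"
  have n: "0 < n" using q by (simp add: n_def)
  have later': "wide s'" "lone_end s'" "shifted s'" if "s < s'" for s'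
    using later[OF that] by (simp_all add: invariants_def)
  have "s + weight n - 4 * k + 4 \<le> L"
  \<comment> \<open>If a run of \<open>a\<close> holds the left end, either it also covers
    \<open>q + k\<close> and the shape persists, or \<open>q + k\<close> is filled from
    \<open>q + 1\<close> and the count rises.\<close>
  proof (cases "a_run y")
    case True
    have shifted_ones: "r (p + k)" if "s \<le> p" "p \<le> q + 1" "p \<noteq> q" for p
      using quiet_after_a_run[OF True, of "p + k"] that full end_one q s
      by (cases "p = q + 1"; intro keep) (auto simp: y_def)
    show ?thesis
    proof (cases "a_run (q + k)")
      case True
      moreover have "r p" if "s + k \<le> p" "p < q + k" for p
        using shifted_ones[of "p - k"] that by simp
      moreover have "r (q + k + 1)" using shifted_ones[of "q + 1"] q by (simp add: algebra_simps)
      ultimately have "s + k + weight n - 4 * k + 4 \<le> L"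
        using q k4 by (intro lone_endD[of _ "q + k"] later') (auto simp: n_def)
      then show ?thesis using k4 by simp
    next
      case False
      have "\<not> b_run (q + k)" using a_run_b_run[OF True, of "q + k"] q by (auto simp: y_def)
      then have "r (q + k)" using fill[of q] end_one False q s by simp
      then have "r p" if "s + k \<le> p" "p \<le> q + 1 + k" for p
        using shifted_ones[of "p - k"] that by (cases "p = q + k") auto
      then have "ones (s + k) (q + 1 + k) = n + 1" using q by (subst ones_full) (auto simp: n_def)
      then have "s + k + weight (n + 1) - 10 * k + 9 \<le> L"
        using later'(1)[of "s + k"] k4 q n by (intro wideD[of _ _ "s + k" "q + 1 + k"]) auto
      then show ?thesis using k4 by (simp add: weight_plus1)
    qed
  next
    case False
    have "\<not> b_run y" using a_run_b_run[OF run, of y] q k4 by (auto simp: y_def)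
    then have ry: "r y" using fill[of "s - 1"] False s full q by (simp add: y_def add.commute add_diff_eq)
    have left: "r p" if "y \<le> p" "p \<le> q + k - 1" for p
    proof (cases "p = y")
      case False
      then show ?thesis
        using keep[of "p - k"] kill_vs_a_run[of p q] shift_vs_a_run[of p q] run full that q s k4
        by (force simp: y_def)
    qed (simp add: ry)
    have wide_y: ?thesis if "n + 1 \<le> ones y (q + k + 1)"
    proof -
      have "y + weight (n + 1) - 10 * k + 9 \<le> L"
        using later'(1)[of y] that n k4 q by (intro wideD[of y _ y "q + k + 1"]) (auto simp: y_def)
      then show ?thesis by (simp add: y_def weight_plus1)
    qed
    have len: "ones y (q + k - 1) = n" using left q k4 by (subst ones_full) (auto simp: n_def y_def)
    have split: "ones y (q + k + 1) = n + (if r (q + k) then 1 else 0) + (if r (q + k + 1) then 1 else 0)"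
      using ones_snoc[of y "q + k + 1"] ones_snoc[of y "q + k"] len q k4 by (simp add: y_def)
    show ?thesis
    proof (cases "r (q + k) \<or> r (q + k + 1)")
      case True
      then show ?thesis using wide_y split by auto
    next
      case False
      \<comment> \<open>A kill here would leave \<open>q + k\<close> free of runs, so the cut at
        \<open>q + 1\<close> would have filled it.\<close>
      have "\<not> kill (q + k + 1)"
        using quiet_before_kill[of "q + k + 1" "q + k"] fill[of q] end_one False q s k4 by auto
      then have "shift (q + k + 1)"
        using keep[of "q + 1"] end_one False q s by (auto simp: algebra_simps)
      moreover have "ones y (q + k + 1 - 1) = n"
        using ones_snoc[of y "q + k"] len False q k4 by (simp add: y_def)
      ultimately have "y + weight n - 5 * k + 5 \<le> L"
        using n q k4 later'(3)[of y] by (intro shiftedD[of y "q + k + 1"]) (auto simp: n_def y_def)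
      then show ?thesis by (simp add: y_def)
    qed
  qed
  then show "s + weight (q - s + 1) - 4 * k + 4 \<le> L" by (simp add: n_def)
qed

lemma one_holeI:
  assumes s: "1 \<le> s" and later: "\<And>s'. s < s' \<Longrightarrow> invariants s'"
  shows "one_hole s"
  unfolding one_hole_def
proof (intro allI impI)
  fix q assume q: "s < q" "q < s + k - 2" and full: "\<forall>p. s \<le> p \<and> p \<le> s + k - 2 \<and> p \<noteq> q \<longrightarrow> r p"
    and run: "a_run q"
  define y where "y = s + k - 1"
  have later': "wide s'" "one_hole s'" if "s < s'" for s'
    using later[OF that] by (simp_all add: invariants_def)
  have W: "weight (k - 1) = weight (k - 2) + 5 * k - 3" using weight_plus1[of "k - 2"] by simp
  show "s + weight (k - 2) - 7 * k + 7 \<le> L"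
  proof (cases "a_run y")
    case True
    have shifted_ones: "r (p + k)" if "s \<le> p" "p \<le> s + k - 2" "p \<noteq> q" for p
      using quiet_after_a_run[OF True, of "p + k"] that full s by (intro keep) (auto simp: y_def)
    show ?thesis
    proof (cases "a_run (q + k)")
      case True
      have "r p" if "s + k \<le> p" "p \<le> s + k + k - 2" "p \<noteq> q + k" for p
        using shifted_ones[of "p - k"] that by simp
      then have "s + k + weight (k - 2) - 7 * k + 7 \<le> L"
        using True later'(2)[of "s + k"] q k4 by (intro one_holeD[of _ "q + k"]) auto
      then show ?thesis using k4 by simp
    next
      case False
      have "\<not> b_run (q + k)" using a_run_b_run[OF True, of "q + k"] q by (auto simp: y_def)
      then have "r (q + k)" using fill[of q] full False q s by simp
      then have "r p" if "s + k \<le> p" "p \<le> s + k + k - 2" for p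
        using shifted_ones[of "p - k"] that by (cases "p = q + k") auto
      then have "ones (s + k) (s + k + k - 2) = k - 1" using k4 by (subst ones_full) auto
      then have "s + k + weight (k - 1) - 10 * k + 9 \<le> L"
        using later'(1)[of "s + k"] k4 by (intro wideD[of _ _ "s + k" "s + k + k - 2"]) auto
      then show ?thesis using k4 W by simp
    qed
  next
    case False
    have "\<not> b_run y" using a_run_b_run[OF run, of y] q k4 by (auto simp: y_def)
    then have ry: "r y" using fill[of "s - 1"] False s full q by (simp add: y_def add.commute add_diff_eq)
    \<comment> \<open>With \<open>y\<close> gained, the cuts from \<open>q + 1\<close> up to the
      translate of \<open>q - 1\<close> are consecutive and fill a wide window.\<close>
    have "r p" if "q + 1 \<le> p" "p \<le> q + k - 1" for p
    proof -
      consider "p \<le> s + k - 2" | "p = y" | "s + k \<le> p" using that by (force simp: y_def)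
      then show ?thesis
      proof cases
        case 3
        then show ?thesis
          using keep[of "p - k"] kill_vs_a_run[of p q] shift_vs_a_run[of p q] run full that q s k4
          by force
      qed (use ry full that q in auto)
    qed
    then have "ones (q + 1) (q + k - 1) = k - 1" using k4 by (subst ones_full) auto
    then have "q + 1 + weight (k - 1) - 10 * k + 9 \<le> L"
      using later'(1)[of "q + 1"] k4 q by (intro wideD[of _ _ "q + 1" "q + k - 1"]) auto
    then show ?thesis using k4 W q by simp
  qed
qed

text \<open>The quiet zone after the shift lets the left end grow to \<open>s + k - 1\<close>. The
  only kill in reach is the exceptional one of \<open>shift_kill\<close>, which for a shift at
  \<open>e + 1\<close> sits at \<open>e + k - 1\<close>.\<close>

lemma gap_after_shift:
  assumes "1 \<le> s" "s < e" "e \<le> s + k - 3" "\<And>p. s \<le> p \<Longrightarrow> p \<le> e \<Longrightarrow> r p" "shift (e + 1)"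
    and p: "s + k - 1 \<le> p" "p \<le> e + k" "p = e + k - 1 \<Longrightarrow> \<not> kill p"
  shows "r p"
proof (cases "p = s + k - 1")
  case True
  then show ?thesis
    using fill[of "s - 1"] quiet_after_shift[OF assms(5), of p] assms by (simp add: add.commute add_diff_eq)
next
  case False
  have "\<not> shift p" using shift_shift[OF assms(5), of p] assms False by linarith
  moreover have "\<not> kill p" using shift_kill[OF assms(5), of p] p False assms by fastforce
  ultimately show ?thesis using keep[of "p - k"] assms p False by auto
qed

lemma gap_shiftI:
  assumes s: "1 \<le> s" and later: "\<And>s'. s < s' \<Longrightarrow> invariants s'"
  shows "gap_shift s"
  unfolding gap_shift_def
proof (intro allI impI)
  fix e assume e: "s \<le> e" "e \<le> s + k - 4" and full: "\<forall>p. s \<le> p \<and> p \<le> e \<longrightarrow> r p" and sh: "shift (e + 1)"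
  define y where "y = s + k - 1"
  have later': "gap s'" "lone_end s'" if "s < s'" for s'
    using later[OF that] by (simp_all add: invariants_def)
  show "s + weight (e - s + 1) - 3 * k + 3 \<le> L"
  proof (cases "e = s")
    case True
    have "r (s + k)"
      using keep[of s] shift_shift[OF sh, of "s + k"] shift_kill[OF sh, of "s + k"] full True s k4 by auto
    then show ?thesis using bounded[of "s + k"] True s k4 by (simp add: weight_1)
  next
    case False
    then have se: "s < e" using e by simp
    note after = gap_after_shift[OF s se _ _ sh]
    show ?thesis
    \<comment> \<open>The exceptional kill separates the last cut from the others. Without it the
      run grows by one.\<close>
    proof (cases "kill (e + k - 1)")
      case True
      have "r p" if "y \<le> p" "p \<le> e + k" "p \<noteq> e + k - 1" for p
        using after[of p] that e full by (simp add: y_def)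
      then have "y + weight (e - s + 1) - 4 * k + 4 \<le> L"
        using later'(2)[of y] e se k4 kill_a_run[OF True]
        by (intro lone_endD[of y "e + k - 1"]) (auto simp: y_def)
      then show ?thesis by (simp add: y_def)
    next
      case False
      have "r p" if "y \<le> p" "p \<le> e + k" for p
        using after[of p] that e full False by (simp add: y_def)
      then have "y + weight (e - s + 1 + 1) - 7 * k + 6 \<le> L"
        using later'(1)[of y] e k4 by (intro gapD[of y "e + k"]) (auto simp: y_def)
      then show ?thesis using k4 weight_plus1[of "e - s + 1"] by (simp add: y_def)
    qed
  qed
qed

text \<open>As for \<open>gap_shift\<close>, but the grown run spans \<open>k - 1\<close> positions,
  so \<open>one_hole\<close> and \<open>wide\<close> replace \<open>lone_end\<close> and
  \<open>gap\<close>.\<close>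

lemma full_gap_shiftI:
  assumes s: "1 \<le> s" and later: "\<And>s'. s < s' \<Longrightarrow> invariants s'"
  shows "full_gap_shift s"
  unfolding full_gap_shift_def
proof (intro impI)
  assume full: "\<forall>p. s \<le> p \<and> p \<le> s + k - 3 \<longrightarrow> r p" and sh: "shift (s + k - 2)"
  define y where "y = s + k - 1"
  have later': "wide s'" "one_hole s'" if "s < s'" for s'
    using later[OF that] by (simp_all add: invariants_def)
  have W: "weight (k - 1) = weight (k - 2) + 5 * k - 3" using weight_plus1[of "k - 2"] by simp
  have sh': "shift (s + k - 3 + 1)" using sh by simp
  note after = gap_after_shift[OF s _ _ _ sh']
  show "s + weight (k - 2) - 6 * k + 6 \<le> L"
  proof (cases "kill (s + 2 * k - 4)")
    case True
    have "r p" if "y \<le> p" "p \<le> y + k - 2" "p \<noteq> s + 2 * k - 4" for p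
      using after[of p] that k4 full by (simp add: y_def)
    then have "y + weight (k - 2) - 7 * k + 7 \<le> L"
      using later'(2)[of y] k4 kill_a_run[OF True]
      by (intro one_holeD[of y "s + 2 * k - 4"]) (auto simp: y_def)
    then show ?thesis by (simp add: y_def)
  next
    case False
    have "r p" if "y \<le> p" "p \<le> y + k - 2" for p
      using after[of p] that k4 full False by (cases "p = s + 2 * k - 4") (auto simp: y_def)
    then have "ones y (y + k - 2) = k - 1" using k4 by (subst ones_full) auto
    then have "y + weight (k - 1) - 10 * k + 9 \<le> L"
      using later'(1)[of y] k4 by (intro wideD[of y _ y "y + k - 2"]) (auto simp: y_def)
    then show ?thesis using W k4 by (simp add: y_def)
  qed
qed

lemma shiftedI:
  assumes s: "1 \<le> s" and later: "\<And>s'. s < s' \<Longrightarrow> invariants s'" and gap_shift: "gap_shift s"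
  shows "shifted s"
  unfolding shifted_def
proof (intro allI impI)
  fix x assume x: "shift x" "s < x" "x \<le> s + k - 2"
    and n: "0 < ones s (x - 1)" "ones s (x - 1) \<le> k - 3"
  define n where "n = ones s (x - 1)"
  define y where "y = s + k - 1"
  have later': "wide s'" "shifted s'" "gap s'" "gap_kill s'" if "s < s'" for s'
    using later[OF that] by (simp_all add: invariants_def)
  have "s + weight n - 5 * k + 5 \<le> L"
  proof (cases "r s")
    case False
    then have "ones (s + 1) (x - 1) = n" using ones_Cons[of s "x - 1"] x by (simp add: n_def)
    moreover from this n have "s + 1 < x"
      using ones_pos[of "s + 1" "x - 1"] by (auto simp: n_def)
    ultimately have "s + 1 + weight n - 5 * k + 5 \<le> L"
      using later'(2)[of "s + 1"] x n by (intro shiftedD[of _ x]) (auto simp: n_def)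
    then show ?thesis by simp
  next
    case rs: True
    show ?thesis
    proof (cases "n = 1")
      case True
      then show ?thesis using bounded[of s] rs s k4 by (simp add: weight_1)
    next
      case False
      then have n2: "2 \<le> n" using n by (simp add: n_def)
      then have sx: "s + 2 \<le> x" using ones_le[of s "x - 1"] x by (simp add: n_def)
      have ry: "r y"
        using fill[of "s - 1"] quiet_after_shift[OF x(1), of y] rs s x sx
        by (simp add: y_def add.commute add_diff_eq)
      have noshift: "\<not> shift (p + k)" if "s \<le> p" "p < x" for p
        using shift_shift[OF x(1), of "p + k"] that x by auto
      have keeps: "r (p + k)" if "s \<le> p" "p < x" "r p" "p = x - 2 \<Longrightarrow> \<not> kill (p + k)" for p
      proof (rule keep)
        show "\<not> kill (p + k)" using shift_kill[OF x(1), of "p + k"] that x by fastforce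
      qed (use noshift[of p] that s in auto)
      have e: "x - 1 + k = x + k - 1" by simp
      show ?thesis
      \<comment> \<open>An ascent pays for the only cut that a kill can take, the one at
        \<open>x - 2\<close>, so with \<open>y\<close> the count grows. Without an ascent the cuts
        form an initial segment of the window.\<close>
      proof (cases "\<exists>p. s \<le> p \<and> p < x - 1 \<and> \<not> r p \<and> r (p + 1)")
        case True
        then obtain p where p: "s \<le> p" "p < x - 1" "\<not> r p" "r (p + 1)" by blast
        have "n \<le> ones (s + k) (x + k - 1)"
        proof (cases "kill (x - 2 + k) \<and> r (x - 2)")
          case True
          then have "p \<noteq> x - 2" using p by auto
          then have "r (p + k)"
            using quiet_after_shift[OF x(1), of "p + k"] p x s by (intro fill) auto
          then show ?thesis
            using ones_shift[of "{x - 2}" s "x - 1" "{p}", unfolded e] keeps p by (simp add: n_def)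
        next
          case False
          then have "r (p + k)" if "s \<le> p" "p < x" "r p" for p
            using keeps[of p] that by auto
          then show ?thesis
            using ones_shift[of "{}" s "x - 1" "{}", unfolded e] by (simp add: n_def)
        qed
        then have "n + 1 \<le> ones y (x + k - 1)"
          using ones_Cons[of y "x + k - 1"] ry x by (simp add: y_def)
        then have "y + weight (n + 1) - 10 * k + 9 \<le> L"
          using later'(1)[of y] n2 x k4 by (intro wideD[of y _ y "x + k - 1"]) (auto simp: y_def)
        then show ?thesis using k4 by (simp add: weight_plus1 y_def)
      next
        case noup: False
        have down: "r i" if i: "s \<le> i" "i \<le> p" "p \<le> x - 1" "r p" for i p
        proof (rule ccontr)
          assume "\<not> r i"
          from step_up[OF i(2) this i(4)]
          obtain j where j: "i \<le> j" "j < p" "\<not> r j" "r (j + 1)" by (elim exE conjE)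
          then have "s \<le> j \<and> j < x - 1 \<and> \<not> r j \<and> r (j + 1)" using i(1,3) by simp
          then show False using noup by (metis (no_types))
        qed
        define Q where "Q = {s..x - 1} \<inter> Collect r"
        have Q: "finite Q" "s \<in> Q" using rs x by (auto simp: Q_def)
        define q where "q = Max Q"
        have "q \<in> Q" using Q unfolding q_def by (intro Max_in) auto
        then have q: "s \<le> q" "q \<le> x - 1" "r q" by (auto simp: Q_def)
        have full: "r p" if "s \<le> p" "p \<le> q" for p using down[of p q] that q by simp
        have "p \<le> q" if "p \<in> Q" for p using Max_ge[OF Q(1) that] by (simp add: q_def)
        then have "Q \<subseteq> {s..q}" by (auto simp: Q_def)
        moreover have "{s..q} \<subseteq> Q" using full q by (auto simp: Q_def)
        ultimately have "Q = {s..q}" by (rule subset_antisym)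
        then have n_q: "n = q - s + 1" using q by (simp add: n_def ones_def Q_def)
        have all: "r p" if "y \<le> p" "p \<le> q + k" "p = x - 2 + k \<Longrightarrow> \<not> kill p" for p
          using keeps[of "p - k"] ry full that q x by (cases "p = y") (auto simp: y_def)
        show ?thesis
        \<comment> \<open>A segment reaching \<open>x - 1\<close> is a \<open>gap_shift\<close> at
          the same \<open>s\<close>. One ending at \<open>x - 2\<close> can lose its last cut to a
          kill while gaining \<open>y\<close>, the tight case. Any other segment grows.\<close>
        proof (cases "q = x - 1")
          case True
          then have "s + weight n - 3 * k + 3 \<le> L"
            using full x n n_q by (intro gap_shiftD[OF gap_shift x(1,2)]) (auto simp: n_def)
          then show ?thesis using k4 by simp
        next
          case False
          show ?thesis
          proof (cases "q = x - 2 \<and> kill (x - 2 + k)")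
            case True
            then have kill: "kill (q + k)" and q2: "q = x - 2" by auto
            have "r p" if "y \<le> p" "p < q + k" for p using all[of p] that q2 by simp
            moreover have "y < q + k" "q + k \<le> y + k - 2" "q + k - y = n"
              using n_q n2 x by (auto simp: y_def q2)
            ultimately have "y + weight n - 6 * k + 6 \<le> L"
              using later'(4)[of y] kill k4 by (intro gap_killD[of y "q + k"]) (auto simp: y_def)
            then show ?thesis by (simp add: y_def)
          next
            case False'': False
            have "r p" if "y \<le> p" "p \<le> q + k" for p
            proof (rule all[OF that])
              assume "p = x - 2 + k"
              then have "q = x - 2" using that False q by linarith
              then show "\<not> kill p" using False'' \<open>p = x - 2 + k\<close> by simp
            qed
            moreover have "y \<le> q + k" "q + k \<le> y + k - 3" "q + k - y + 1 = n + 1"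
              using n_q n q by (auto simp: y_def n_def)
            ultimately have "y + weight (n + 1) - 7 * k + 6 \<le> L"
              using later'(3)[of y] k4 by (intro gapD[of y "q + k"]) (auto simp: y_def)
            then show ?thesis using k4 by (simp add: weight_plus1 y_def)
          qed
        qed
      qed
    qed
  qed
  then show "s + weight (ones s (x - 1)) - 5 * k + 5 \<le> L" by (simp add: n_def)
qed

lemma narrowI:
  assumes s: "1 \<le> s" and later: "\<And>s'. s < s' \<Longrightarrow> invariants s'"
  shows "narrow s"
  unfolding narrow_def
proof (intro impI)
  define n where "n = ones s (s + k - 3)"
  assume "0 < ones s (s + k - 3)"
  then have n: "0 < n" by (simp add: n_def)
  have later': "wide s'" "narrow s'" "shifted s'" if "s < s'" for s'
    using later[OF that] by (simp_all add: invariants_def)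
  have "s + weight n - 9 * k + 8 \<le> L"
  proof (cases "r s")
    case False
    then have "n \<le> ones (s + 1) (s + k - 3)" using ones_Cons[of s "s + k - 3"] k4 by (simp add: n_def)
    then have "s + 1 + weight n - 9 * k + 8 \<le> L"
      using later'(2)[of "s + 1"] n by (intro narrowD[of _ _ "s + 1" "s + k - 3"]) auto
    then show ?thesis by simp
  next
    case rs: True
    show ?thesis
    proof (cases "n = 1")
      case True
      then show ?thesis using bounded[of s] rs s k4 by (simp add: weight_1)
    next
      case False
      then have n2: "2 \<le> n" using n by simp
      show ?thesis
      \<comment> \<open>The outcomes are \<open>stay\<close>, \<open>grow\<close>,
        \<open>kill\<close>, \<open>shift\<close> in this order; the last two use up the whole
        slack.\<close>
      proof (cases rule: revolution[OF s rs])
        case 1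
        then have "s + k + weight n - 9 * k + 8 \<le> L"
          using later'(2)[of "s + k"] n k4
          by (intro narrowD[of _ _ "s + k" "s + 2 * k - 3"]) (auto simp: n_def)
        then show ?thesis using k4 by simp
      next
        case 2
        then have "s + k - 1 + weight n - 9 * k + 8 \<le> L"
          using later'(2)[of "s + k - 1"] n k4
          by (intro narrowD[of _ _ "s + k - 1" "s + 2 * k - 4"]) (auto simp: n_def)
        then show ?thesis using k4 by simp
      next
        case (3 z)
        then have "s + k - 1 + weight n - 10 * k + 9 \<le> L"
          using later'(1)[of "s + k - 1"] n k4
          by (intro wideD[of _ _ "s + k - 1" "s + 2 * k - 3"]) (auto simp: n_def)
        then show ?thesis by simp
      next
        case (4 x)
        have "0 < ones (s + k) (x - 1)" using 4(5) n2 by (simp add: n_def)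
        then have "s + k < x" using ones_pos[of "s + k" "x - 1"] by auto
        then have "s + k + weight (n - 1) - 5 * k + 5 \<le> L"
          using later'(3)[of "s + k"] 4 n2 k4 ones_le[of "s + k" "x - 1"]
          by (intro shiftedD[of _ x]) (auto simp: n_def)
        then show ?thesis by (simp add: weight_minus1)
      qed
    qed
  qed
  then show "s + weight (ones s (s + k - 3)) - 9 * k + 8 \<le> L" by (simp add: n_def)
qed

lemma wideI:
  assumes s: "1 \<le> s" and later: "\<And>s'. s < s' \<Longrightarrow> invariants s'" and narrow: "narrow s"
  shows "wide s"
  unfolding wide_def
proof (intro impI)
  define n where "n = ones s (s + k - 2)"
  define y where "y = s + k - 1"
  define e where "e = s + k - 2"
  assume "0 < ones s (s + k - 2)"
  then have n: "0 < n" by (simp add: n_def)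
  have later': "wide s'" "narrow s'" "shifted s'" "full_gap_shift s'" "gap_kill s'" if "s < s'" for s'
    using later[OF that] by (simp_all add: invariants_def)
  have next_wide: "s + weight n - 10 * k + 9 \<le> L" if "n \<le> ones (s + k) (e + k)"
  proof -
    have "s + k + weight n - 10 * k + 9 \<le> L"
      using later'(1)[of "s + k"] n k4 that by (intro wideD[of _ _ "s + k" "e + k"]) (auto simp: e_def)
    then show ?thesis using k4 by simp
  qed
  have n_e: "n = ones s e" by (simp add: n_def e_def)
  have "s + weight n - 10 * k + 9 \<le> L"
  \<comment> \<open>What remains after the easy cases: cuts at both ends of the window and a left
    end held by a run of \<open>b\<close>.\<close>
  proof (cases "r s \<and> r e \<and> n \<noteq> 1 \<and> \<not> r y \<and> \<not> a_run y")
    case False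
    then consider "\<not> r s" | "\<not> r e" | "r s" "n = 1" | "r s" "r y" | "a_run y" by blast
    then show ?thesis
    proof cases
      case 1
      then have "n \<le> ones (s + 1) e" using ones_Cons[of s e] k4 by (simp add: n_e e_def)
      then have "s + 1 + weight n - 9 * k + 8 \<le> L"
        using later'(2)[of "s + 1"] n by (intro narrowD[of _ _ "s + 1" e]) (auto simp: e_def)
      then show ?thesis using k4 by simp
    next
      case 2
      then have "n = ones s (s + k - 3)" using ones_snoc[of s e] k4 by (simp add: n_e e_def)
      then show ?thesis using narrow n k4 by (simp add: narrow_def)
    next
      case 3
      then show ?thesis using bounded[of s] s k4 by (simp add: weight_1)
    next
      case 4
      have "ones s y = n + 1" using 4 ones_snoc[of s y] k4 by (simp add: n_def y_def)
      then have "n \<le> ones (s + 1) y" using 4 ones_Cons[of s y] k4 by (simp add: y_def)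
      then have "s + 1 + weight n - 10 * k + 9 \<le> L"
        using later'(1)[of "s + 1"] n by (intro wideD[of _ _ "s + 1" y]) (auto simp: y_def)
      then show ?thesis by simp
    next
      case 5
      then show ?thesis
        using a_run_keeps_ones[of y s e] s by (intro next_wide) (simp add: n_e y_def e_def)
    qed
  next
    case True
    then have rs: "r s" and re: "r e" and n2: "2 \<le> n" and ry: "\<not> r y" and notA: "\<not> a_run y"
      using n by auto
    have B: "b_run y" using fill[of "s - 1"] rs ry notA s by (auto simp: y_def add.commute add_diff_eq)
    show ?thesis
    proof (cases "\<exists>z. kill z \<and> s + k \<le> z \<and> z \<le> e + k")
      case False
      then have "\<not> kill z" if "s + k \<le> z" "z \<le> e + k" for z using that by blast
      then have nokill: "\<not> kill (p + k)" if "s \<le> p" "p \<le> e" for p using that by simp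
      show ?thesis
      proof (cases "\<exists>x. shift x \<and> s + k \<le> x \<and> x \<le> e + k \<and> r (x - k) \<and> \<not> r (x - k + 1)")
        case False
        have "r (p + k)" if "s \<le> p" "p \<le> e" "r p" for p
        proof (rule keep)
          show "r (p + 1)" if "shift (p + k)"
            using False that \<open>s \<le> p\<close> \<open>p \<le> e\<close> \<open>r p\<close>
            by (metis add_diff_cancel_right' add_le_cancel_right)
        qed (use that s nokill in auto)
        then show ?thesis using ones_shift[of "{}" s e "{}"] by (intro next_wide) (simp add: n_e)
      next
        case True
        then obtain x where x: "shift x" "s + k \<le> x" "x \<le> e + k" "r (x - k)" "\<not> r (x - k + 1)"
          by blast
        have keeps: "r (p + k)" if "s \<le> p" "p \<le> e" "r p" "p \<noteq> x - k" for p
        proof (rule keep)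
          show "r (p + 1)" if "shift (p + k)"
            using shift_shift[of "p + k" x] shift_shift[of x "p + k"] that x \<open>p \<noteq> x - k\<close> \<open>s \<le> p\<close>
              \<open>p \<le> e\<close> by (fastforce simp: e_def)
        qed (use that s nokill in auto)
        show ?thesis
        \<comment> \<open>Since \<open>e\<close> is a cut, the hole at \<open>x - k + 1\<close> is
          followed by an ascent, unless the lost cut is \<open>e\<close> itself.\<close>
        proof (cases "x = e + k")
          case False
          then obtain p where p: "x - k + 1 \<le> p" "p < e" "\<not> r p" "r (p + 1)"
            using step_up[of "x - k + 1" e] x re by auto
          have "r (p + k)"
            using quiet_after_shift[OF x(1), of "p + k"] p x s by (intro fill) (auto simp: e_def)
          then show ?thesis
            using ones_shift[of "{x - k}" s e "{p}"] keeps p x(2) by (intro next_wide) (simp add: n_e)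
        next
          case xe: True
          define m where "m = ones (s + k) (x - 1)"
          have "n = ones s (e - 1) + 1" using ones_snoc[of s e] re k4 by (simp add: n_e e_def)
          moreover have "ones s (e - 1) \<le> ones (s + k) (e - 1 + k)"
            using ones_shift[of "{}" s "e - 1" "{}"] keeps xe by simp
          ultimately have m: "n - 1 \<le> m" using xe by (simp add: m_def add.commute add_diff_eq)
          have "m \<le> k - 2" using ones_le[of "s + k" "x - 1"] k4 xe by (simp add: m_def e_def)
          then consider "m = k - 2" | "m \<le> k - 3" by linarith
          then show ?thesis
          proof cases
            case 1
            then have "\<forall>p. s + k \<le> p \<and> p \<le> x - 1 \<longrightarrow> r p"
              using ones_eq_length_iff[of "s + k" "x - 1"] xe k4 by (simp add: m_def e_def)
            then have "s + k + weight (k - 2) - 6 * k + 6 \<le> L"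
              using later'(4)[of "s + k"] x(1) xe k4 by (intro full_gap_shiftD[of _ x]) (auto simp: e_def)
            moreover have "weight (n - 1) \<le> weight (k - 2)" using m 1 by (intro weight_mono) simp
            ultimately show ?thesis by (simp add: weight_minus1)
          next
            case 2
            have "s + k + weight (n - 1) - 5 * k + 5 \<le> L"
              using later'(3)[of "s + k"] x(1) xe k4 n2 m 2
              by (intro shiftedD[of _ x]) (auto simp: e_def m_def)
            then show ?thesis using k4 by (simp add: weight_minus1)
          qed
        qed
      qed
    next
      case True
      then obtain z where z: "kill z" "s + k \<le> z" "z \<le> e + k" by blast
      \<comment> \<open>The run of \<open>b\<close> before \<open>y\<close> leaves room for a kill
        only at the far end. The kill word then starts with the last \<open>b\<close> of this run,
        which forces a shift at \<open>s + k\<close>.\<close>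
      have ze: "z = e + k"
        using a_run_b_run[OF kill_a_run[OF z(1)] B] z k4 by (auto simp: y_def e_def)
      then have yz: "y + k - 1 = z" by (simp add: y_def e_def)
      have sh: "shift (s + k)"
        using b_run_kill_shift[OF B, unfolded yz, OF z(1)] by (simp add: y_def)
      have nokill: "\<not> kill (p + k)" if "s \<le> p" "p < e" for p
        using kill_kill[of "p + k" z] z that ze by (fastforce simp: e_def)
      \<comment> \<open>Strictly between this shift and this kill no event occurs: cuts are kept and
        holes directly left of a cut are filled.\<close>
      have mid: "r (p + k)" if "s < p" "p < e" "r p \<or> r (p + 1)" for p
      proof -
        have "\<not> a_run (p + k)" "\<not> b_run (p + k)" "\<not> kill (p + k)" "\<not> shift (p + k)"
          using quiet_after_shift[OF sh, of "p + k"] that by (auto simp: e_def)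
        then show ?thesis using that keep[of p] fill[of p] s by auto
      qed
      have first: "r (s + k)" if "r (s + 1)" using keep[of s] nokill[of s] that rs s k4 by (simp add: e_def)
      show ?thesis
      proof (cases "r (s + 1)")
        case r1: True
        show ?thesis
        proof (cases "\<exists>p. s \<le> p \<and> p \<le> e \<and> \<not> r p")
          case True
          then obtain p0 where "s \<le> p0" "p0 \<le> e" "\<not> r p0" by blast
          moreover from this have "s < p0" using rs by (cases "p0 = s") auto
          ultimately obtain p where p: "p0 \<le> p" "p < e" "\<not> r p" "r (p + 1)"
            using step_up[of p0 e] re by auto
          have "s < p" using p(1) \<open>s < p0\<close> by simp
          have "r (i + k)" if "s \<le> i" "i \<le> e" "r i" "i \<noteq> e" for i
            using mid[of i] first r1 that by (cases "i = s") auto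
          then show ?thesis
            using ones_shift[of "{e}" s e "{p}"] mid[of p] p \<open>s < p\<close> by (intro next_wide) (simp add: n_e)
        next
          case False
          then have "n = k - 1" using ones_full[of s e] k4 by (simp add: n_e e_def)
          moreover have "r p" if "s + k \<le> p" "p \<le> e + k - 1" for p
            using False mid[of "p - k"] first r1 that by (cases "p = s + k") auto
          then have "s + k + weight (k - 2) - 6 * k + 6 \<le> L"
            using later'(5)[of "s + k"] z(1) ze k4
            by (intro gap_killD[of _ z]) (auto simp: e_def)
          moreover have "weight (k - 1) = weight (k - 2) + 5 * k - 3" using weight_plus1[of "k - 2"] by simp
          ultimately show ?thesis by simp
        qed
      next
        \<comment> \<open>Now \<open>s\<close> may fall to the shift and \<open>e\<close> to the
          kill, so two filled holes are wanted: the last hole \<open>h\<close> and an earlier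
          ascent.\<close>
        case r1: False
        have "s + 1 \<le> e" using k4 by (simp add: e_def)
        define Q where "Q = {s + 1..e} - Collect r"
        define h where "h = Max Q"
        have Q: "finite Q" "s + 1 \<in> Q" using r1 \<open>s + 1 \<le> e\<close> by (auto simp: Q_def)
        then have "h \<in> Q" unfolding h_def by (intro Max_in) auto
        then have h: "s < h" "h < e" "\<not> r h" using re by (auto simp: Q_def dest: order_le_imp_less_or_eq)
        have after_h: "r p" if "h < p" "p \<le> e" for p
        proof (rule ccontr)
          assume "\<not> r p"
          then have "p \<in> Q" using that h by (simp add: Q_def)
          then show False using Max_ge[OF Q(1), of p] that(1) by (simp add: h_def)
        qed
        have hk: "r (h + k)" using mid[of h] after_h[of "h + 1"] h by simp
        show ?thesis
        proof (cases "\<exists>p. s < p \<and> p < h \<and> r p")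
          case True
          then obtain p0 where "s < p0" "p0 < h" "r p0" by blast
          then obtain p where "s + 1 \<le> p" "p < p0" "\<not> r p" "r (p + 1)"
            using step_up[of "s + 1" p0] r1 by auto
          then have p: "s < p" "p < h" "\<not> r p" "r (p + 1)" using \<open>p0 < h\<close> by auto
          have "r (i + k)" if "s \<le> i" "i \<le> e" "r i" "i \<notin> {s, e}" for i
            using mid[of i] that by auto
          moreover have "r (p + k)" using mid[of p] p h by simp
          moreover have "s \<noteq> e" using h by simp
          ultimately show ?thesis
            using ones_shift[of "{s, e}" s e "{p, h}"] hk p h by (intro next_wide) (force simp: n_e)
        next
          \<comment> \<open>Without an earlier ascent, \<open>s\<close> stands alone and the other
            \<open>n - 1\<close> cuts are those after \<open>h\<close>; together with
            \<open>h + k\<close> they give a run ending at the kill.\<close>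
          case False
          have "ones (s + 1) h = 0"
            using ones_pos[of "s + 1" h] False h by (force simp: ones_def)
          moreover have "ones (h + 1) e = e - h" using ones_full[of "h + 1" e] after_h h by simp
          moreover have "ones s e = ones s s + ones (s + 1) h + ones (h + 1) e"
            using ones_split[of s "s + 1" e] ones_split[of "s + 1" "h + 1" e] h by simp
          ultimately have n_h: "n - 1 = e - h" using rs ones_single[of s] by (simp add: n_e)
          have "r p" if "h + k \<le> p" "p \<le> e + k - 1" for p
            using hk mid[of "p - k"] after_h[of "p - k"] h that by (cases "p = h + k") auto
          then have "h + k + weight (n - 1) - 6 * k + 6 \<le> L"
            using later'(5)[of "h + k"] z(1) ze k4 n_h n2 h
            by (intro gap_killD[of _ z]) (auto simp: e_def)
          then show ?thesis using h k4 by (simp add: weight_minus1)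
        qed
      qed
    qed
  qed
  then show "s + weight (ones s (s + k - 2)) - 10 * k + 9 \<le> L" by (simp add: n_def)
qed

section \<open>Backward induction on the window position\<close>

lemma invariants_late:
  assumes "L < s" "1 \<le> s" shows "invariants s"
proof -
  have none: "\<not> r p" if "s \<le> p" for p using bounded[of p] assms that k4 by auto
  have "\<not> 0 < ones s b" for b using ones_pos[of s b] none by blast
  then have "wide s" "narrow s" "shifted s"
    by (simp_all add: wide_def narrow_def shifted_def)
  moreover have rs: "\<not> r s" "s \<le> s + k - 2" "s \<le> s + k - 3" using none[of s] k4 by auto
  have "killed s" using rs by (simp add: killed_def)
  moreover have "lone_end s" unfolding lone_end_def using rs by (metis order_refl)
  moreover have "one_hole s" unfolding one_hole_def using rs by (metis order_refl less_irrefl)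
  moreover have "gap s" "gap_kill s" "gap_shift s" "full_gap_shift s"
    unfolding gap_def gap_kill_def gap_shift_def full_gap_shift_def using rs by (metis order_refl)+
  ultimately show ?thesis by (simp add: invariants_def)
qed

text \<open>At equal \<open>s\<close>, \<open>shifted\<close> relies on \<open>gap_shift\<close> and
  \<open>wide\<close> on \<open>narrow\<close>; everything else refers to larger positions, and
  beyond \<open>L\<close> all shapes are void.\<close>

lemma invariants: "1 \<le> s \<Longrightarrow> invariants s"
proof (induction "nat (L + 1 - s)" arbitrary: s rule: less_induct)
  case less
  show ?case
  proof (cases "L < s")
    case True
    then show ?thesis using less.prems by (rule invariants_late)
  next
    case False
    have later: "invariants s'" if "s < s'" for s'
      using less.hyps[of s'] less.prems that False by auto
    note gap_shift = gap_shiftI[OF less.prems later]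
    note narrow = narrowI[OF less.prems later]
    show ?thesis
      unfolding invariants_def[of s]
      using gap_shift narrow wideI[OF less.prems later narrow] shiftedI[OF less.prems later gap_shift]
        killedI[OF less.prems later] lone_endI[OF less.prems later] one_holeI[OF less.prems later]
        gapI[OF less.prems later] gap_killI[OF less.prems later] full_gap_shiftI[OF less.prems later]
      by blast
  qed
qed

lemma length_bound:
  assumes init: "\<And>p. 0 \<le> p \<Longrightarrow> p < k \<Longrightarrow> r p"
  shows "5 * k\<^sup>2 - 17 * k + 13 \<le> L"
proof -
  have "0 \<le> L" using bounded[of 0] init[of 0] k4 by simp
  then have "\<not> r (int (nat L))" using bounded[of L] k4 by auto
  \<comment> \<open>\<open>p0\<close> is the first unreachable position. As all earlier ones are
    reachable, only a kill can cause it, and the \<open>k - 1\<close> positions after it are cuts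
    again. The bound is \<open>wide\<close> for this full window with \<open>p0\<close> at least
    \<open>k\<close>.\<close>
  define m where "m = (LEAST m. \<not> r (int m))"
  have m: "\<not> r (int m)" unfolding m_def by (rule LeastI) fact
  define p0 where "p0 = int m"
  have before: "r p" if "0 \<le> p" "p < p0" for p
    using not_less_Least[of "nat p" "\<lambda>m. \<not> r (int m)"] that by (auto simp: p0_def m_def)
  have p0: "k \<le> p0" "\<not> r p0" using init[of p0] m by (force simp: p0_def)+
  have "kill p0"
    using rec[OF p0(1)] p0 before[of "p0 - k"] before[of "p0 - k + 1"] k4
      shift_vs_a_run[of p0 p0] shift_vs_b_run[of p0 p0] by auto
  then have "r p" if "p0 + 1 \<le> p" "p \<le> p0 + 1 + k - 2" for p
    using keep[of "p - k"] before[of "p - k"] quiet_after_a_run[OF kill_a_run, of p0 p] that p0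
    by auto
  then have "ones (p0 + 1) (p0 + 1 + k - 2) = k - 1" using k4 by (subst ones_full) auto
  then have "p0 + 1 + weight (k - 1) - 10 * k + 9 \<le> L"
    using invariants[of "p0 + 1"] p0 k4 by (simp add: invariants_def wide_def)
  then show ?thesis using p0 by (simp add: weight_def power2_eq_square algebra_simps)
qed

end

section \<open>Cuts and completability\<close>

text \<open>All positions below \<open>k\<close> are initial cuts, since a factor may start anywhere
  inside a block.\<close>

inductive cut :: "int \<Rightarrow> (int \<Rightarrow> letter) \<Rightarrow> int \<Rightarrow> bool" for k w where
  cut_init: "0 \<le> p \<Longrightarrow> p < k \<Longrightarrow> cut k w p"
| cut_long: "cut k w p \<Longrightarrow> \<not> kill_at k w (p + k) \<Longrightarrow> \<not> shift_at k w (p + k) \<Longrightarrow> cut k w (p + k)"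
| cut_short: "cut k w p \<Longrightarrow> \<not> run_end A k w (p + k - 1) \<Longrightarrow> \<not> run_end B k w (p + k - 1) \<Longrightarrow>
    cut k w (p + k - 1)"

lemma cut_recurrence_cut:
  assumes "4 \<le> k" shows "cut_recurrence k w (cut k w)"
proof
  fix p assume p: "k \<le> p"
  show "cut k w p \<longleftrightarrow>
      cut k w (p - k) \<and> \<not> kill_at k w p \<and> \<not> shift_at k w p \<or>
      cut k w (p - k + 1) \<and> \<not> run_end A k w p \<and> \<not> run_end B k w p" (is "_ \<longleftrightarrow> ?R")
  proof
    assume "cut k w p"
    then show ?R using p by cases auto
  next
    assume ?R
    then show "cut k w p"
      using cut_long[of k w "p - k"] cut_short[of k w "p - k + 1"] by auto
  qed
qed (fact assms)

lemma cut_nonneg: "cut k w p \<Longrightarrow> 0 < k \<Longrightarrow> 0 \<le> p"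
  by (induction rule: cut.induct) auto

section \<open>Blocks of \<open>S k\<close> as conditions on letters\<close>

definition letters :: "letter list \<Rightarrow> int \<Rightarrow> letter" where
  "letters x i = x ! nat i"

lemma run_end_letters:
  assumes "p + n \<le> length x"
  shows "run_end c (int n + 1) (letters x) (int (p + n)) \<longleftrightarrow> take n (drop p x) = replicate n c"
proof
  assume *: "run_end c (int n + 1) (letters x) (int (p + n))"
  show "take n (drop p x) = replicate n c"
  proof (rule nth_equalityI)
    fix i assume "i < length (take n (drop p x))"
    then have "i < n" by simp
    then have "letters x (int (p + i)) = c" using * by (simp add: run_end_def)
    then show "take n (drop p x) ! i = replicate n c ! i" using \<open>i < n\<close> assms
      by (simp add: letters_def del: of_nat_add)
  qed (use assms in simp)
next
  assume *: "take n (drop p x) = replicate n c"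
  show "run_end c (int n + 1) (letters x) (int (p + n))"
    unfolding run_end_def
  proof (intro allI impI)
    fix i assume i: "int (p + n) - (int n + 1) < i \<and> i < int (p + n)"
    then have "nat i - p < n" "p + (nat i - p) = nat i" by auto
    moreover from this have "take n (drop p x) ! (nat i - p) = c" by (subst *) simp
    ultimately show "letters x i = c" using assms by (simp add: letters_def)
  qed
qed

text \<open>Both lengths are described relative to \<open>p + k\<close>, as in \<open>cut\<close>; a
  short block ends one position earlier.\<close>

lemma block_in_S_iff:
  assumes "p + length b \<le> length x" "b = take (length b) (drop p x)" "1 \<le> k"
  shows "b \<in> S k \<longleftrightarrow>
    length b = k \<and> \<not> kill_at (int k) (letters x) (int (p + k)) \<and> \<not> shift_at (int k) (letters x) (int (p + k)) \<or>
    length b = k - 1 \<and> \<not> run_end A (int k) (letters x) (int (p + k) - 1) \<and>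
      \<not> run_end B (int k) (letters x) (int (p + k) - 1)"
proof -
  obtain n where n: "k = Suc n" using assms(3) by (cases k) auto
  have short: "b = replicate n c \<longleftrightarrow> run_end c (int k) (letters x) (int (p + k) - 1)"
    if "length b = n" for c
    using run_end_letters[of p n x c] assms that n by (simp add: add.commute)
  have kill: "b = B # replicate n A \<longleftrightarrow> kill_at (int k) (letters x) (int (p + k))"
    if "length b = k"
  proof -
    have "p < length x" using assms(1) that n by simp
    then have "b = x ! p # take n (drop (Suc p) x)"
      using assms(2) that n Cons_nth_drop_Suc[of p x] by (metis take_Suc_Cons)
    then have "b = B # replicate n A \<longleftrightarrow> x ! p = B \<and> take n (drop (Suc p) x) = replicate n A" by simp
    also have "\<dots> \<longleftrightarrow> kill_at (int k) (letters x) (int (p + k))"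
      using run_end_letters[of "Suc p" n x A] assms that n
      by (auto simp: kill_at_def letters_def add.commute)
    finally show ?thesis .
  qed
  have shift: "b = replicate n B @ [A] \<longleftrightarrow> shift_at (int k) (letters x) (int (p + k))"
    if "length b = k"
  proof -
    have "b = take n (drop p x) @ [x ! (p + n)]"
      using assms that n take_Suc_conv_app_nth[of n "drop p x"] by simp
    then have "b = replicate n B @ [A] \<longleftrightarrow> take n (drop p x) = replicate n B \<and> x ! (p + n) = A" by simp
    also have "\<dots> \<longleftrightarrow> shift_at (int k) (letters x) (int (p + k))"
      using run_end_letters[of p n x B] assms that n
      by (auto simp: shift_at_def letters_def add.commute nat_add_distrib)
    finally show ?thesis .
  qed
  show ?thesis
    using short kill shift n by (auto simp: S_def words_of_length_def)
qed

section \<open>Translating between cuts and factorisations\<close>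

lemma star_append: "a \<in> star X \<Longrightarrow> b \<in> X \<Longrightarrow> a @ b \<in> star X"
proof -
  assume "a \<in> star X" "b \<in> X"
  then obtain ws where "a = concat ws" "set ws \<subseteq> X" by (auto simp: star_def)
  then show ?thesis using \<open>b \<in> X\<close> unfolding star_def by (intro CollectI exI[of _ "ws @ [b]"]) auto
qed

lemma word_in_star: "b \<in> X \<Longrightarrow> b \<in> star X"
  using star_append[of "[]" X b] by (force simp: star_def intro: exI[of _ "[]"])

lemma cut_imp_star:
  assumes "cut (int k) (letters x) p" "p \<le> int (length x)" "2 \<le> k"
  shows "\<exists>u. u @ take (nat p) x \<in> star (S k)"
  using assms(1,2)
proof (induction rule: cut.induct)
  case (cut_init p)
  \<comment> \<open>Left padding by at least one \<open>a\<close> gives a block of length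
    \<open>k\<close> that is allowed, because both excluded words of this length begin with
    \<open>b\<close>.\<close>
  define u where "u = replicate (k - nat p) A"
  have "u @ take (nat p) x \<noteq> B # v" for v
    using cut_init by (cases "k - nat p") (auto simp: u_def)
  moreover have "length (u @ take (nat p) x) = k" using cut_init by (auto simp: u_def)
  moreover have "replicate (k - 1) B @ [A] = B # replicate (k - 2) B @ [A]"
    using assms(3) by (cases "k - 1") auto
  ultimately have "u @ take (nat p) x \<in> S k" using assms(3) by (auto simp: S_def words_of_length_def)
  then show ?case by (blast intro: word_in_star)
next
  case (cut_long p)
  have "0 \<le> p" using cut_nonneg[OF cut_long.hyps(1)] assms(3) by simp
  then obtain q where q: "p = int q" by (metis nonneg_int_cases)
  obtain u where u: "u @ take q x \<in> star (S k)" using cut_long q by auto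
  have "take k (drop q x) \<in> S k"
    using block_in_S_iff[of q "take k (drop q x)" x k] cut_long q assms(3) by auto
  then have "u @ take (q + k) x \<in> star (S k)" using star_append[OF u] by (simp add: take_add)
  then show ?case using q by (auto simp: nat_add_distrib)
next
  case (cut_short p)
  have "0 \<le> p" using cut_nonneg[OF cut_short.hyps(1)] assms(3) by simp
  then obtain q where q: "p = int q" by (metis nonneg_int_cases)
  obtain u where u: "u @ take q x \<in> star (S k)" using cut_short q assms(3) by auto
  have "take (k - 1) (drop q x) \<in> S k"
    using block_in_S_iff[of q "take (k - 1) (drop q x)" x k] cut_short q assms(3) by auto
  then have "u @ take (q + (k - 1)) x \<in> star (S k)" using star_append[OF u] by (simp add: take_add)
  moreover have "nat (p + int k - 1) = q + (k - 1)" using q assms(3) by auto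
  ultimately show ?case by auto
qed

lemma cut_imp_completable:
  assumes "cut (int k) (letters x) p" "p \<le> int (length x)" "int (length x) < p + int k" "2 \<le> k"
  shows "\<not> uncompletable k x"
proof -
  obtain u where u: "u @ take (nat p) x \<in> star (S k)" using cut_imp_star assms by blast
  have p: "0 \<le> p" using cut_nonneg[OF assms(1)] assms(4) by simp
  \<comment> \<open>Right padding by at least one \<open>b\<close>: both excluded words of length
    \<open>k\<close> end in \<open>a\<close>.\<close>
  define v where "v = replicate (k - (length x - nat p)) B"
  have "k - (length x - nat p) \<noteq> 0" using assms p by linarith
  then have last: "last (drop (nat p) x @ v) = B" "v \<noteq> []" by (auto simp: v_def)
  have "length (drop (nat p) x @ v) = k" using assms p by (auto simp: v_def)
  moreover have "last (B # replicate (k - 1) A) = A" "last (replicate (k - 1) B @ [A]) = A"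
    using assms(4) by auto
  ultimately have "length (drop (nat p) x @ v) = k" "drop (nat p) x @ v \<noteq> B # replicate (k - 1) A"
      "drop (nat p) x @ v \<noteq> replicate (k - 1) B @ [A]"
    using last(1) by (metis letter.distinct(1))+
  then have "drop (nat p) x @ v \<in> S k" unfolding S_def words_of_length_def by blast
  then have "(u @ take (nat p) x) @ drop (nat p) x @ v \<in> star (S k)" by (rule star_append[OF u])
  then have "u @ x @ v \<in> star (S k)" by (metis append.assoc append_take_drop_id)
  then show ?thesis by (auto simp: uncompletable_def Fact_def)
qed

text \<open>Steps have length at most \<open>k\<close>, so cuts cannot jump over the final stretch
  that \<open>near\<close> forbids. Hence the unspecified letters beyond the end of \<open>x\<close>
  never matter.\<close>

lemma uncompletable_bounded:
  assumes "uncompletable k x" "2 \<le> k" "cut (int k) (letters x) p"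
  shows "p + int k \<le> int (length x)"
proof -
  let ?L = "int (length x)"
  have near: "p + int k \<le> ?L" if "cut (int k) (letters x) p" "p \<le> ?L" for p
    using cut_imp_completable[OF that] assms by linarith
  have "int k \<le> ?L"
  proof (rule ccontr)
    assume "\<not> int k \<le> ?L"
    then show False using near[of ?L] cut_init[of ?L "int k" "letters x"] assms(2) by simp
  qed
  show ?thesis
    using assms(3)
  proof (induction rule: cut.induct)
    case (cut_init p)
    then show ?case using near[OF cut.cut_init] \<open>int k \<le> ?L\<close> by simp
  next
    case (cut_long p)
    then show ?case using near[OF cut.cut_long] by simp
  next
    case (cut_short p)
    then show ?case using near[OF cut.cut_short] by simp
  qed
qed

lemma S_length: "b \<in> S k \<Longrightarrow> length b = k \<or> length b = k - 1"
  by (auto simp: S_def words_of_length_def)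

lemma star_imp_cut:
  assumes "set ws \<subseteq> S k" "u @ take p x = concat ws" "p \<le> length x" "2 \<le> k"
  shows "cut (int k) (letters x) (int p)"
  using assms(1-3)
proof (induction ws arbitrary: p rule: rev_induct)
  case Nil
  then have "p = 0" using assms(4) by auto
  then show ?case using assms(4) by (auto intro: cut_init)
next
  case (snoc b ws)
  show ?case
  proof (cases "p < k")
    case True
    then show ?thesis by (auto intro: cut_init)
  next
    case False
    \<comment> \<open>The last block is no longer than \<open>k \<le> p\<close>, so it lies inside
      \<open>x\<close> and does not reach into \<open>u\<close>.\<close>
    have b: "b \<in> S k" "length b \<le> p" using snoc.prems S_length[of b k] False by auto
    define q where "q = p - length b"
    have pq: "p = q + length b" using b by (simp add: q_def)
    have "(u @ take q x) @ take (length b) (drop q x) = concat ws @ b"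
      using snoc.prems(2) by (simp add: pq take_add)
    moreover have "length (take (length b) (drop q x)) = length b" using snoc.prems pq by simp
    ultimately have eq: "u @ take q x = concat ws" "b = take (length b) (drop q x)"
      by (metis append_eq_append_conv)+
    have "cut (int k) (letters x) (int q)" using snoc.IH[of q] snoc.prems eq pq by auto
    then show ?thesis
      using block_in_S_iff[of q b x k] b(1) eq(2) snoc.prems(3) pq assms(4)
        cut_long[of "int k" "letters x" "int q"] cut_short[of "int k" "letters x" "int q"]
      by (auto simp: of_nat_diff algebra_simps)
  qed
qed

lemma concat_prefix_near:
  assumes "\<And>b. b \<in> set ws \<Longrightarrow> length b \<le> k" "T \<le> length (concat ws)" "0 < k"
  shows "\<exists>ws1 ws2. ws = ws1 @ ws2 \<and> length (concat ws1) \<le> T \<and> T < length (concat ws1) + k"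
  using assms(1,2)
proof (induction ws rule: rev_induct)
  case (snoc b ws)
  consider "T \<le> length (concat ws)" | "length (concat ws) < T" "T < length (concat ws) + k"
    | "T = length (concat ws) + k"
    using snoc.prems(1)[of b] snoc.prems(2) by fastforce
  then show ?case
  proof cases
    case 1
    then show ?thesis using snoc by fastforce
  next
    case 2
    then show ?thesis by (intro exI[of _ ws] exI[of _ "[b]"]) auto
  next
    case 3
    then have "T = length (concat (ws @ [b]))" using snoc.prems(1)[of b] snoc.prems(2) by simp
    then show ?thesis using assms(3) by (intro exI[of _ "ws @ [b]"] exI[of _ "[]"]) auto
  qed
qed (use assms(3) in auto)

lemma completable_imp_cut:
  assumes "\<not> uncompletable k x" "2 \<le> k" "k \<le> length x"
  shows "\<exists>p. cut (int k) (letters x) p \<and> p \<le> int (length x) \<and> int (length x) < p + int k"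
proof -
  obtain u v ws where ws: "u @ x @ v = concat ws" "set ws \<subseteq> S k"
    using assms(1) by (auto simp: uncompletable_def Fact_def star_def)
  have "length b \<le> k" if "b \<in> set ws" for b using S_length[of b k] subsetD[OF ws(2) that] by linarith
  moreover have "length u + length x \<le> length (concat ws)" unfolding ws(1)[symmetric] by simp
  ultimately obtain ws1 ws2 where ws1: "ws = ws1 @ ws2" "length (concat ws1) \<le> length u + length x"
      "length u + length x < length (concat ws1) + k"
    using concat_prefix_near[of ws k "length u + length x"] assms(2) by auto
  \<comment> \<open>The subtraction is exact: as \<open>x\<close> has length at least
    \<open>k\<close>, this boundary lies after the end of \<open>u\<close>.\<close>
  define p where "p = length (concat ws1) - length u"
  have p: "length (concat ws1) = length u + p" "p \<le> length x" using ws1 assms(3) by (auto simp: p_def)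
  have "concat ws1 = take (length (concat ws1)) (concat ws)" by (simp add: ws1(1))
  also have "\<dots> = u @ take p x" using p by (simp add: ws(1)[symmetric])
  finally have "cut (int k) (letters x) (int p)"
    using star_imp_cut[of ws1 k u p x] ws(2) ws1(1) p(2) assms(2) by simp
  then show ?thesis using ws1 p by (intro exI[of _ "int p"]) auto
qed

section \<open>A shortest uncompletable word\<close>

text \<open>After \<open>b\<close>, \<open>k\<close> letters \<open>a\<close> and
  \<open>k - 1\<close> letters \<open>b\<close>, cycle \<open>m\<close> is the tight cycle with
  \<open>i = m + 1\<close>. The extremal word stops after the first letter of cycle
  \<open>k - 3\<close>.\<close>

definition long_word :: "int \<Rightarrow> int \<Rightarrow> letter" where
  "long_word k j =
    (if j = 0 then B else if j \<le> k then A else if j < 2 * k then B else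
      let m = (j - 2 * k) div (5 * k - 4); t = (j - 2 * k) mod (5 * k - 4)
      in if t \<le> k + m then A else if t < 3 * k - 3 then B else if t < 4 * k - 3 then A else B)"

lemma long_word_block:
  assumes "4 \<le> k" "0 \<le> m" "0 \<le> t" "t < 5 * k - 4"
  shows "long_word k (2 * k + m * (5 * k - 4) + t) =
    (if t \<le> k + m then A else if t < 3 * k - 3 then B else if t < 4 * k - 3 then A else B)"
proof -
  define c where "c = 5 * k - 4"
  have c: "0 < c" "t < c" using assms by (auto simp: c_def)
  have "(m * c + t) div c = m" "(m * c + t) mod c = t"
    using c assms(3) by (auto simp: div_add1_eq)
  moreover have "0 \<le> m * c" using assms(2) c by simp
  then have "2 * k + m * c + t \<noteq> 0" "\<not> 2 * k + m * c + t \<le> k" "\<not> 2 * k + m * c + t < 2 * k"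
    using assms(1,3) by linarith+
  ultimately show ?thesis by (simp add: long_word_def Let_def c_def[symmetric])
qed

section \<open>Following the unreachable positions through the extremal word\<close>

context cut_recurrence
begin

lemma zero_hold:
  assumes "k \<le> p" "a_run p \<or> b_run p" "\<not> r (p - k)" shows "\<not> r p"
  using rec[of p] assms by blast

lemma zero_shift:
  assumes "k \<le> p" "shift p" "\<not> r (p - k + 1)" shows "\<not> r p"
  using rec[of p] assms by blast

lemma zero_any:
  assumes "k \<le> p" "\<not> r (p - k)" "\<not> r (p - k + 1)" shows "\<not> r p"
  using rec[of p] assms by blast

lemma zero_interval:
  assumes "0 \<le> a" "\<And>p. a \<le> p \<Longrightarrow> p \<le> b \<Longrightarrow> \<not> r p" "a + k \<le> p" "p \<le> b + k - 1"
  shows "\<not> r p"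
proof (rule zero_any)
  show "\<not> r (p - k)" "\<not> r (p - k + 1)" using assms(2)[of "p - k"] assms(2)[of "p - k + 1"] assms(3,4) by auto
qed (use assms(1,3) in simp)

text \<open>Here \<open>g\<close> is the length of the gap of reachable cuts directly before the kill at \<open>p\<close>; the next kill
  is at \<open>p + 5 * k - 4\<close>, where the gap has length \<open>g - 1\<close>.\<close>

lemma cycle_shrinks_gap:
  assumes g: "2 \<le> g" "g \<le> k - 2" and p: "k \<le> p"
    and b0: "w (p - k) = B"
    and a1: "\<And>i. p - k < i \<Longrightarrow> i < p + k - g \<Longrightarrow> w i = A"
    and b1: "\<And>i. p + k - g \<le> i \<Longrightarrow> i < p + 2 * k - 2 \<Longrightarrow> w i = B"
    and a2: "\<And>i. p + 2 * k - 2 \<le> i \<Longrightarrow> i < p + 3 * k - 2 \<Longrightarrow> w i = A"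
    and b2: "\<And>i. p + 3 * k - 2 \<le> i \<Longrightarrow> i < p + 4 * k - 3 \<Longrightarrow> w i = B"
    and a3: "w (p + 4 * k - 3) = A"
    and z: "\<And>i. p - k < i \<Longrightarrow> i < p - g \<Longrightarrow> \<not> r i"
  shows "\<And>i. p + 4 * k - 4 < i \<Longrightarrow> i < p + 5 * k - 3 - g \<Longrightarrow> \<not> r i"
    and "\<And>i. g = 2 \<Longrightarrow> p + 3 * k - 1 \<le> i \<Longrightarrow> i \<le> p + 4 * k - 2 \<Longrightarrow> \<not> r i"
proof -
  have "kill p" using b0 a1 g by (auto simp: kill_at_def run_end_def)
  then have rp: "\<not> r p" using p by (rule kill_zero[rotated])
  \<comment> \<open>By \<open>zero_interval\<close> an interval of zeros loses its right end per
    revolution. The runs in \<open>z1\<close> and \<open>z2\<close> prevent this twice; the kill at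
    \<open>p\<close> and the shift in \<open>z3\<close> each add a zero on the left.\<close>
  have z1: "\<not> r i" if "p \<le> i" "i \<le> p + k - g - 1" for i
  proof -
    have "i = p \<or> p < i \<and> i \<le> p + k - g - 2 \<or> i = p + k - g - 1 \<and> p < i" using that by arith
    then consider "i = p" | "p < i" "i \<le> p + k - g - 2" | "i = p + k - g - 1" "p < i" by blast
    then show ?thesis
    proof cases
      case 2
      then show ?thesis using zero_interval[of "p - k + 1" "p - g - 1" i] z p by simp
    next
      case 3
      have "a_run i" unfolding run_end_def using a1 3 that by auto
      then show ?thesis using zero_hold[of i] z[of "i - k"] p 3 g by simp
    qed (simp add: rp)
  qed
  have z2: "\<not> r i" if "p + k \<le> i" "i \<le> p + 2 * k - g - 1" for i
  proof (cases "i = p + 2 * k - g - 1")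
    case True
    have "b_run i" unfolding run_end_def using b1 True g by auto
    then show ?thesis using zero_hold[of i] z1[of "i - k"] p True g k4 by simp
  next
    case False
    then show ?thesis using zero_interval[of p "p + k - g - 1" i] z1 that p k4 by simp
  qed
  have z3: "\<not> r i" if "p + 2 * k - 1 \<le> i" "i \<le> p + 3 * k - g - 2" for i
  proof (cases "i = p + 2 * k - 1")
    case True
    have "shift i" unfolding shift_at_def run_end_def using b1 a2[of "i - 1"] True g k4 by auto
    then show ?thesis using zero_shift[of i] z2[of "i - k + 1"] p True g k4 by simp
  next
    case False
    then show ?thesis using zero_interval[of "p + k" "p + 2 * k - g - 1" i] z2 that p k4 by simp
  qed
  \<comment> \<open>This separate zero is copied by a run of \<open>b\<close> in \<open>z5\<close>;
    the shift in \<open>z6\<close> adds its right neighbour, and both join the left end of the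
    interval descending from \<open>z4\<close>.\<close>
  have "kill (p + 3 * k - 3)" unfolding kill_at_def run_end_def
    using a2 b1[of "p + 3 * k - 3 - k"] g k4 by auto
  then have zk: "\<not> r (p + 3 * k - 3)" using p k4 by (intro kill_zero) auto
  have z4: "\<not> r i" if "p + 3 * k - 1 \<le> i" "i \<le> p + 4 * k - g - 3" for i
    using zero_interval[of "p + 2 * k - 1" "p + 3 * k - g - 2" i] z3 that p k4 by simp
  have "b_run (p + 4 * k - 3)" unfolding run_end_def using b2 by auto
  then have z5: "\<not> r (p + 4 * k - 3)" using zero_hold[of "p + 4 * k - 3"] zk p k4 by (simp add: algebra_simps)
  have "shift (p + 4 * k - 2)" unfolding shift_at_def run_end_def
    using b2 a3 k4 by auto
  then have z6: "\<not> r (p + 4 * k - 2)"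
    using zero_shift[of "p + 4 * k - 2"] z4[of "p + 3 * k - 1"] p g k4 by (simp add: algebra_simps)
  show "\<not> r i" if "p + 4 * k - 4 < i" "i < p + 5 * k - 3 - g" for i
  proof -
    have "i = p + 4 * k - 3 \<or> i = p + 4 * k - 2 \<or> p + 4 * k - 1 \<le> i" using that by arith
    then consider "i = p + 4 * k - 3" | "i = p + 4 * k - 2" | "p + 4 * k - 1 \<le> i" by blast
    then show ?thesis
    proof cases
      case 3
      then show ?thesis using zero_interval[of "p + 3 * k - 1" "p + 4 * k - g - 3" i] z4 that p k4 by simp
    qed (use z5 z6 in auto)
  qed
  show "\<not> r i" if "g = 2" "p + 3 * k - 1 \<le> i" "i \<le> p + 4 * k - 2" for i
  proof -
    have "i \<le> p + 4 * k - g - 3 \<or> i = p + 4 * k - 4 \<or> i = p + 4 * k - 3 \<or> i = p + 4 * k - 2"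
      using that by arith
    then consider "i \<le> p + 4 * k - g - 3" | "i = p + 4 * k - 4" | "i = p + 4 * k - 3" | "i = p + 4 * k - 2"
      by blast
    then show ?thesis
    proof cases
      case 1
      then show ?thesis using z4 that by simp
    next
      \<comment> \<open>For \<open>g = 2\<close> the interval of \<open>z3\<close> ends directly
        before the zero \<open>zk\<close>, so together they close the last hole.\<close>
      case 2
      then have i: "i - k = p + 3 * k - 4" "i - k + 1 = p + 3 * k - 3" by auto
      show ?thesis
      proof (rule zero_any)
        show "\<not> r (i - k)" unfolding i(1) using z3[of "p + 3 * k - 4"] that(1) k4 by simp
        show "\<not> r (i - k + 1)" unfolding i(2) by (rule zk)
      qed (use 2 p k4 in simp)
    qed (use z5 z6 in auto)
  qed
qed

lemma long_word_zeros:
  assumes w: "\<And>j. 0 \<le> j \<Longrightarrow> j \<le> 2 * k + (k - 3) * (5 * k - 4) \<Longrightarrow> w j = long_word k j"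
    and m: "int m \<le> k - 4" and b: "b = 2 * k + int m * (5 * k - 4)"
  shows "\<And>i. b \<le> i \<Longrightarrow> i \<le> b + int m \<Longrightarrow> \<not> r i"
    and "\<And>i. int m = k - 4 \<Longrightarrow> b + 4 * k - 2 \<le> i \<Longrightarrow> i \<le> b + 5 * k - 3 \<Longrightarrow> \<not> r i"
proof -
  have blk: "(\<forall>i. b' + (5 * k - 4) \<le> i \<and> i \<le> b' + (5 * k - 4) + int n + 1 \<longrightarrow> \<not> r i) \<and>
      (int n = k - 4 \<longrightarrow> (\<forall>i. b' + 4 * k - 2 \<le> i \<and> i \<le> b' + 5 * k - 3 \<longrightarrow> \<not> r i))"
    if n: "int n \<le> k - 4" and b': "b' = 2 * k + int n * (5 * k - 4)"
      and z: "\<And>i. b' \<le> i \<Longrightarrow> i \<le> b' + int n \<Longrightarrow> \<not> r i" for n b'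
  proof -
    \<comment> \<open>The first kill of cycle \<open>n\<close> comes after \<open>k - 1\<close>
      letters of the cycle. The \<open>n + 1\<close> zeros at its start leave a gap of
      \<open>k - 2 - n\<close> before the kill.\<close>
    define p where "p = b' + k - 1"
    define g where "g = k - 2 - int n"
    have "(int n + 1) * (5 * k - 4) \<le> (k - 3) * (5 * k - 4)"
      using n k4 by (intro mult_right_mono) auto
    then have last: "b' + (5 * k - 4) \<le> 2 * k + (k - 3) * (5 * k - 4)"
      unfolding b' by (simp add: distrib_right)
    have b'2: "2 * k \<le> b'" using k4 by (simp add: b')
    have wb: "w (b' + t) = (if t \<le> k + int n then A else if t < 3 * k - 3 then B
        else if t < 4 * k - 3 then A else B)" if "0 \<le> t" "t < 5 * k - 4" for t
      using w[of "b' + t"] long_word_block[OF k4, of "int n" t] that last b'2 k4 by (simp add: b')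
    have wl: "w (b' - 1) = long_word k (b' - 1)" using w last b'2 k4 by simp
    have w0: "w (b' - 1) = B"
    proof (cases n)
      case 0
      then show ?thesis using wl k4 by (simp add: b' long_word_def)
    next
      case (Suc n')
      then have e: "b' - 1 = 2 * k + int n' * (5 * k - 4) + (5 * k - 5)"
        by (simp add: b' distrib_right)
      have "long_word k (b' - 1) = B"
        unfolding e by (subst long_word_block) (use k4 n Suc in auto)
      then show ?thesis using wl by simp
    qed
    have wend: "w (b' + (5 * k - 4)) = A"
    proof -
      have e: "b' + (5 * k - 4) = 2 * k + (int n + 1) * (5 * k - 4) + 0"
        by (simp add: b' distrib_right)
      have "w (b' + (5 * k - 4)) = long_word k (b' + (5 * k - 4))" using w last b'2 k4 by simp
      also have "\<dots> = A" unfolding e by (subst long_word_block) (use k4 in auto)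
      finally show ?thesis .
    qed
    have g: "2 \<le> g" "g \<le> k - 2" "k \<le> p" using n b'2 k4 by (auto simp: g_def p_def)
    have letters: "w (p - k) = B"
      "\<And>i. p - k < i \<Longrightarrow> i < p + k - g \<Longrightarrow> w i = A"
      "\<And>i. p + k - g \<le> i \<Longrightarrow> i < p + 2 * k - 2 \<Longrightarrow> w i = B"
      "\<And>i. p + 2 * k - 2 \<le> i \<Longrightarrow> i < p + 3 * k - 2 \<Longrightarrow> w i = A"
      "\<And>i. p + 3 * k - 2 \<le> i \<Longrightarrow> i < p + 4 * k - 3 \<Longrightarrow> w i = B"
      "w (p + 4 * k - 3) = A"
    proof -
      show "w (p - k) = B" using w0 by (simp add: p_def)
      show "w i = A" if "p - k < i" "i < p + k - g" for i
        using wb[of "i - b'"] that n k4 by (simp add: p_def g_def)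
      show "w i = B" if "p + k - g \<le> i" "i < p + 2 * k - 2" for i
        using wb[of "i - b'"] that n k4 by (simp add: p_def g_def)
      show "w i = A" if "p + 2 * k - 2 \<le> i" "i < p + 3 * k - 2" for i
        using wb[of "i - b'"] that n k4 by (simp add: p_def g_def)
      show "w i = B" if "p + 3 * k - 2 \<le> i" "i < p + 4 * k - 3" for i
        using wb[of "i - b'"] that n k4 by (simp add: p_def g_def)
      have e: "p + 4 * k - 3 = b' + (5 * k - 4)" by (simp add: p_def)
      show "w (p + 4 * k - 3) = A" unfolding e by (rule wend)
    qed
    have "\<not> r i" if "p - k < i" "i < p - g" for i using z[of i] that by (simp add: p_def g_def)
    note blk = cycle_shrinks_gap[OF g letters this]
    show ?thesis
      using blk(1) blk(2) by (auto simp: p_def g_def)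
  qed
  have zeros: "int m \<le> k - 4 \<Longrightarrow> 2 * k + int m * (5 * k - 4) \<le> i \<Longrightarrow>
      i \<le> 2 * k + int m * (5 * k - 4) + int m \<Longrightarrow> \<not> r i" for m i
  proof (induction m arbitrary: i)
    case 0
    then have i: "i = 2 * k" by simp
    have "0 \<le> (k - 3) * (5 * k - 4)" using k4 by simp
    then have w': "w j = long_word k j" if "0 \<le> j" "j \<le> 2 * k" for j using w that by simp
    \<comment> \<open>The prefix creates the first zero by a kill at \<open>k\<close>, and its run
      of \<open>b\<close> carries it to the start of the first cycle.\<close>
    have "kill k" using w' k4 by (auto simp: kill_at_def run_end_def long_word_def)
    then have "\<not> r k" by (intro kill_zero) auto
    moreover have "b_run (2 * k)" using w' k4 by (auto simp: run_end_def long_word_def)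
    ultimately show ?case using zero_hold[of "2 * k"] i k4 by simp
  next
    case (Suc m)
    have "\<And>i. 2 * k + int m * (5 * k - 4) \<le> i \<Longrightarrow> i \<le> 2 * k + int m * (5 * k - 4) + int m \<Longrightarrow> \<not> r i"
      using Suc by simp
    from blk[of m "2 * k + int m * (5 * k - 4)", OF _ refl this] Suc.prems
    show ?case by (auto simp: distrib_right)
  qed
  show "\<not> r i" if "b \<le> i" "i \<le> b + int m" for i using zeros[OF m, of i] that b by simp
  then show "\<not> r i" if "int m = k - 4" "b + 4 * k - 2 \<le> i" "i \<le> b + 5 * k - 3" for i
    using blk[OF m b] that by blast
qed

end

section \<open>Combining both bounds\<close>

lemma linear_le_quadratic:
  fixes k :: nat
  assumes "4 \<le> k" shows "17 * k \<le> 5 * k\<^sup>2"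
  using mult_right_mono[OF assms, of k] unfolding power2_eq_square by linarith

lemma uncompletable_length:
  assumes "4 \<le> k" "uncompletable k x"
  shows "5 * k\<^sup>2 - 17 * k + 13 \<le> length x"
proof -
  interpret cut_recurrence "int k" "letters x" "cut (int k) (letters x)"
    using assms(1) by (intro cut_recurrence_cut) simp
  interpret vanishing_cuts "int k" "letters x" "cut (int k) (letters x)" "int (length x)"
    by unfold_locales (use uncompletable_bounded assms in auto)
  have "5 * (int k)\<^sup>2 - 17 * int k + 13 \<le> int (length x)"
    by (rule length_bound) (rule cut_init)
  \<comment> \<open>Moving \<open>17 * k\<close> to the other side avoids truncated subtraction on
    the way back to natural numbers.\<close>
  then have "int (5 * k\<^sup>2 + 13) \<le> int (length x + 17 * k)" by simp
  then have "5 * k\<^sup>2 + 13 \<le> length x + 17 * k" by (simp only: of_nat_le_iff)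
  then show ?thesis using linear_le_quadratic[OF assms(1)] by linarith
qed

lemma long_word_uncompletable:
  assumes "4 \<le> k"
  shows "\<exists>x. uncompletable k x \<and> length x = 5 * k\<^sup>2 - 17 * k + 13"
proof -
  define N where "N = 5 * k\<^sup>2 - 17 * k + 13"
  define x where "x = map (\<lambda>i. long_word (int k) (int i)) [0..<N]"
  have "N + 17 * k = 5 * k\<^sup>2 + 13" using linear_le_quadratic[OF assms] by (simp add: N_def)
  then have "int (N + 17 * k) = int (5 * k\<^sup>2 + 13)" by (rule arg_cong)
  then have "int N + 17 * int k = 5 * (int k)\<^sup>2 + 13" by simp
  then have N: "int N = 2 * int k + (int k - 3) * (5 * int k - 4) + 1"
    by (simp add: power2_eq_square algebra_simps)
  interpret cut_recurrence "int k" "letters x" "cut (int k) (letters x)"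
    using assms by (intro cut_recurrence_cut) simp
  have w: "letters x j = long_word (int k) j"
    if "0 \<le> j" "j \<le> 2 * int k + (int k - 3) * (5 * int k - 4)" for j
    using that N by (simp add: letters_def x_def nat_less_iff)
  define b where "b = 2 * int k + int (k - 4) * (5 * int k - 4)"
  \<comment> \<open>With this equation the zeros of the final cycle are exactly the last
    \<open>k\<close> positions, those ending at \<open>int N\<close>.\<close>
  have b: "b + 5 * int k - 3 = int N" using N assms by (simp add: b_def of_nat_diff algebra_simps)
  have zero: "\<not> cut (int k) (letters x) p" if "int N < p + int k" "p \<le> int N" for p
    by (rule long_word_zeros(2)[OF w _ b_def]) (use that b assms in \<open>auto simp: of_nat_diff\<close>)
  have "0 \<le> int (k - 4) * (5 * int k - 4)" using assms by simp
  then have "int k \<le> int N" using b assms unfolding b_def by linarith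
  then have "uncompletable k x" using completable_imp_cut[of k x] zero \<open>int k \<le> int N\<close> assms by (auto simp: x_def)
  then show ?thesis by (intro exI[of _ x]) (simp add: x_def N_def)
qed

theorem theorem4:
  fixes k :: nat
  assumes "k \<ge> 4"
  shows "(\<forall>w. uncompletable k w \<longrightarrow> length w \<ge> 5*k^2 - 17*k + 13)
     \<and> (LEAST n. \<exists>w. uncompletable k w \<and> length w = n) = 5*k^2 - 17*k + 13"
proof
  show "\<forall>w. uncompletable k w \<longrightarrow> length w \<ge> 5*k^2 - 17*k + 13"
    using uncompletable_length[OF assms] by blast
  show "(LEAST n. \<exists>w. uncompletable k w \<and> length w = n) = 5*k^2 - 17*k + 13"
    using uncompletable_length[OF assms] long_word_uncompletable[OF assms]
    by (intro Least_equality) auto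
qed

end
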